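(* Let $n\ge 1$ and $m\ge 1$. There is a subset $E\subset H^0(\mathbb{CP}^n,\mathcal O(m))$ of zero Lebesgue measure such that every section $s\in H^0(\mathbb{CP}^n,\mathcal O(m))\setminus E$ has only non-degenerate isolated critical points. In other words, for every such $s$ the function $|s|^2$ on $\mathbb{CP}^n$ is a generalized Morse function.
   Context: The line bundle $\mathcal O(m)$ carries the Fubini–Study Hermitian metric, for which a section $s$, viewed as a homogeneous polynomial of degree $m$ in $Z_0,\dots,Z_n$, has pointwise norm $|s|^2=|s(Z)|^2/\left(\sum_i|Z_i|^2\right)^m$. Let $\nabla$ be its Chern connection. A critical point of a holomorphic section $s$ is a point where $\nabla s=0$; in a local frame $e$ with $|e|^2=e^{-\phi}$ and $s=fe$ this means $\partial f-f\,\partial\phi=0$. Away from the zero locus of $s$, these are exactly the critical points of $\log|s|^2$ (equivalently of $|s|^2$), and such a critical point is non-degenerate if the real Hessian of $\log|s|^2$ there is nonsingular. Let $f$ be a smooth real function on a compact manifold $M$. A connected submanifold $N\subset M$ is a non-degenerate critical manifold of $f$ if $df\equiv 0$ along $N$ and the Hessian of $f$ is non-degenerate on the normal bundle of $N$ (for $N$ a point this is a non-degenerate critical point). The function $f$ is a generalized Morse function if its critical set is a disjoint union of non-degenerate critical manifolds. The critical set of $|s|^2$ is the union of the critical points of $s$ and the zero locus of $s$. *)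

theory Defs
  imports "HOL-Analysis.Analysis" "HOL-Library.Disjoint_Sets"
begin

section \<open>Complex projective space\<close>

text \<open>
  Homogeneous coordinates are indexed by \<open>'n option\<close>, so that \<open>'n cpn\<close> is
  the projective space of complex dimension \<open>CARD('n)\<close>, and this dimension
  ranges over all positive integers; the coordinate \<open>Z_0\<close> has index \<open>None\<close>.
\<close>

definition proportional ::
    "(complex, 'n::finite option) vec \<Rightarrow> (complex, 'n option) vec \<Rightarrow> bool" where
  "proportional Z W \<longleftrightarrow> Z \<noteq> 0 \<and> W \<noteq> 0 \<and> (\<exists>c. W = c *s Z)"

lemma proportional_refl: "Z \<noteq> 0 \<Longrightarrow> proportional Z Z"
  unfolding proportional_def by (intro conjI exI[of _ 1]) simp_all

lemma part_equivp_proportional: "part_equivp (proportional :: (complex, 'n::finite option) vec \<Rightarrow> _)"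
proof (rule part_equivpI)
  have "(\<chi> i. (1 :: complex)) \<noteq> (0 :: (complex, 'n option) vec)"
    by (simp add: vec_eq_iff)
  then show "\<exists>Z :: (complex, 'n option) vec. proportional Z Z"
    by (blast intro: proportional_refl)
  show "symp (proportional :: (complex, 'n option) vec \<Rightarrow> _)"
  proof (rule sympI)
    fix Z W :: "(complex, 'n option) vec"
    assume "proportional Z W"
    then obtain c where c: "Z \<noteq> 0" "W \<noteq> 0" "W = c *s Z"
      by (auto simp: proportional_def)
    then have "c \<noteq> 0" by auto
    with c(3) have "Z = inverse c *s W"
      by (simp add: vector_smult_assoc)
    with c(1,2) show "proportional W Z"
      unfolding proportional_def by blast
  qed
  show "transp (proportional :: (complex, 'n option) vec \<Rightarrow> _)"
  proof (rule transpI)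
    fix X Y Z :: "(complex, 'n option) vec"
    assume "proportional X Y" "proportional Y Z"
    then obtain c d where "X \<noteq> 0" "Z \<noteq> 0" "Y = c *s X" "Z = d *s Y"
      by (auto simp: proportional_def)
    then have "Z = (d * c) *s X" by (simp add: vector_smult_assoc)
    with \<open>X \<noteq> 0\<close> \<open>Z \<noteq> 0\<close> show "proportional X Z"
      unfolding proportional_def by blast
  qed
qed

quotient_type (overloaded) 'n cpn =
    "(complex, 'n::finite option) vec" / partial: "proportional"
  morphisms rep_cpn abs_cpn
  by (rule part_equivp_proportional)

lemma proportional_rep_abs: "Z \<noteq> 0 \<Longrightarrow> proportional (rep_cpn (abs_cpn Z)) Z"
  by (rule Quotient3_rep_abs[OF Quotient3_cpn proportional_refl])

text \<open>The quotient topology of \<open>\<complex>\<^sup>n\<^sup>+\<^sup>1 - {0}\<close>.\<close>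

instantiation cpn :: (finite) topological_space
begin

definition open_cpn :: "'a cpn set \<Rightarrow> bool" where
  "open_cpn U \<longleftrightarrow> open {Z. Z \<noteq> 0 \<and> abs_cpn Z \<in> U}"

instance
proof
  have "{Z :: (complex, 'a option) vec. Z \<noteq> 0} = - {0}" by auto
  then show "open (UNIV :: 'a cpn set)"
    by (simp add: open_cpn_def open_Compl)
next
  fix S T :: "'a cpn set"
  assume "open S" "open T"
  moreover have "{Z. Z \<noteq> 0 \<and> abs_cpn Z \<in> S \<inter> T} =
      {Z. Z \<noteq> 0 \<and> abs_cpn Z \<in> S} \<inter> {Z. Z \<noteq> 0 \<and> abs_cpn Z \<in> T}" by auto
  ultimately show "open (S \<inter> T)"
    by (simp add: open_cpn_def open_Int)
next
  fix K :: "'a cpn set set"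
  assume "\<forall>S\<in>K. open S"
  moreover have "{Z. Z \<noteq> 0 \<and> abs_cpn Z \<in> \<Union>K} =
      (\<Union>S\<in>K. {Z. Z \<noteq> 0 \<and> abs_cpn Z \<in> S})" by auto
  ultimately show "open (\<Union>K)"
    by (auto simp: open_cpn_def)
qed

end

text \<open>
  The standard affine charts: \<open>affine_vec i\<close> fills the coordinate \<open>i\<close> with \<open>1\<close>
  and the others with the entries of \<open>z\<close> (after exchanging the positions
  \<open>None\<close> and \<open>i\<close>), and \<open>affine_pt i\<close> is the inverse of the affine chart on
  \<open>{Z_i \<noteq> 0}\<close>.
\<close>

definition affine_vec ::
    "'n::finite option \<Rightarrow> (complex, 'n) vec \<Rightarrow> (complex, 'n option) vec" where
  "affine_vec i z =
    (\<chi> j. case Transposition.transpose None i j of None \<Rightarrow> 1 | Some k \<Rightarrow> z $ k)"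

definition affine_pt :: "'n::finite option \<Rightarrow> (complex, 'n) vec \<Rightarrow> 'n cpn" where
  "affine_pt i z = abs_cpn (affine_vec i z)"

lemma affine_vec_nth_self [simp]: "affine_vec i z $ i = 1"
  by (simp add: affine_vec_def)

lemma affine_vec_nonzero [simp]: "affine_vec i z \<noteq> 0"
  by (metis affine_vec_nth_self zero_index zero_neq_one)


section \<open>Sections of \<open>\<O>(m)\<close>\<close>

definition multi_indices :: "nat \<Rightarrow> ('n::finite option \<Rightarrow> nat) set" where
  "multi_indices m = {\<alpha>. (\<Sum>i\<in>UNIV. \<alpha> i) = m}"

definition hom_poly ::
    "nat \<Rightarrow> (('n::finite option \<Rightarrow> nat) \<Rightarrow> complex) \<Rightarrow> (complex, 'n option) vec \<Rightarrow> complex" where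
  "hom_poly m c Z = (\<Sum>\<alpha>\<in>multi_indices m. c \<alpha> * (\<Prod>i\<in>UNIV. Z $ i ^ \<alpha> i))"

text \<open>\<open>H\<^sup>0(\<complex>\<P>\<^sup>n, \<O>(m))\<close>, as the space of homogeneous polynomials of degree \<open>m\<close>.\<close>

definition H0 :: "nat \<Rightarrow> ((complex, 'n::finite option) vec \<Rightarrow> complex) set" where
  "H0 m = range (hom_poly m)"

text \<open>
  Lebesgue null sets of the finite-dimensional complex vector space \<open>H0 m\<close>, in the
  linear coordinates given by the coefficients of the monomials.  The product of
  copies of \<open>lborel\<close> is completed, since null sets need not be Borel.
\<close>

definition H0_null_set :: "nat \<Rightarrow> ((complex, 'n::finite option) vec \<Rightarrow> complex) set \<Rightarrow> bool" where
  "H0_null_set m E \<longleftrightarrow> E \<subseteq> H0 m \<and>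
    {c \<in> PiE (multi_indices m) (\<lambda>_. UNIV). hom_poly m c \<in> E}
      \<in> null_sets (completion (PiM (multi_indices m) (\<lambda>_. lborel :: complex measure)))"

text \<open>
  The squared Fubini--Study norm \<open>|s|\<^sup>2\<close> as a function on projective space, evaluated
  on a representative; independence of the representative is shown below.
\<close>

definition fs_norm2 ::
    "nat \<Rightarrow> ((complex, 'n::finite option) vec \<Rightarrow> complex) \<Rightarrow> 'n cpn \<Rightarrow> real" where
  "fs_norm2 m s p =
    (cmod (s (rep_cpn p)))\<^sup>2 / (\<Sum>i\<in>UNIV. (cmod (rep_cpn p $ i))\<^sup>2) ^ m"

lemma hom_poly_scale: "hom_poly m c (a *s Z) = a ^ m * hom_poly m c Z"
proof -
  have "c \<alpha> * (\<Prod>i\<in>UNIV. (a *s Z) $ i ^ \<alpha> i) = a ^ m * (c \<alpha> * (\<Prod>i\<in>UNIV. Z $ i ^ \<alpha> i))"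
    if "\<alpha> \<in> multi_indices m" for \<alpha>
    using that by (simp add: multi_indices_def power_mult_distrib prod.distrib flip: power_sum)
  then show ?thesis
    unfolding hom_poly_def sum_distrib_left by (rule sum.cong[OF refl])
qed

lemma fs_norm2_abs_cpn:
  assumes hom: "\<And>a Z. s (a *s Z) = a ^ m * s Z" and Z: "Z \<noteq> 0"
  shows "fs_norm2 m s (abs_cpn Z) = (cmod (s Z))\<^sup>2 / (\<Sum>i\<in>UNIV. (cmod (Z $ i))\<^sup>2) ^ m"
proof -
  define W where "W = rep_cpn (abs_cpn Z)"
  obtain a where a: "Z = a *s W"
    using proportional_rep_abs[OF Z] by (auto simp: W_def proportional_def)
  have a0: "a \<noteq> 0" using a Z by auto
  have "(cmod (s Z))\<^sup>2 = (cmod a ^ 2) ^ m * (cmod (s W))\<^sup>2"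
  proof -
    have "(cmod a ^ m)\<^sup>2 = (cmod a ^ 2) ^ m"
      by (metis power_mult mult.commute)
    then show ?thesis
      by (simp only: a hom norm_mult norm_power power_mult_distrib)
  qed
  moreover have "(\<Sum>i\<in>UNIV. (cmod (Z $ i))\<^sup>2) = cmod a ^ 2 * (\<Sum>i\<in>UNIV. (cmod (W $ i))\<^sup>2)"
    by (simp add: a norm_mult power_mult_distrib sum_distrib_left)
  ultimately show ?thesis
    using a0 by (simp add: fs_norm2_def W_def[symmetric] power_mult_distrib)
qed


section \<open>Critical points of sections\<close>

text \<open>The holomorphic derivative \<open>\<partial>g/\<partial>z_k = (\<partial>g/\<partial>x_k - \<i> \<partial>g/\<partial>y_k) / 2\<close>.\<close>

definition wirtinger ::
    "((complex, 'n::finite) vec \<Rightarrow> complex) \<Rightarrow> (complex, 'n) vec \<Rightarrow> 'n \<Rightarrow> complex" where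
  "wirtinger g z k =
    (frechet_derivative g (at z) (axis k 1) - \<i> * frechet_derivative g (at z) (axis k \<i>)) / 2"

text \<open>
  On \<open>{Z_i \<noteq> 0}\<close> the line bundle has the holomorphic frame \<open>e = Z_i ^ m\<close>;
  then \<open>s = f e\<close> with \<open>f z = s (affine_vec i z)\<close>, and \<open>|e|\<^sup>2 = exp (- \<phi>)\<close>.
\<close>

definition fs_potential :: "nat \<Rightarrow> 'n::finite option \<Rightarrow> (complex, 'n) vec \<Rightarrow> real" where
  "fs_potential m i z = - ln (fs_norm2 m (\<lambda>Z. Z $ i ^ m) (affine_pt i z))"

text \<open>The coefficients of \<open>\<nabla>s = (\<partial>f - f \<partial>\<phi>) e\<close> with respect to \<open>dz_k\<close>.\<close>

definition chern_nabla ::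
    "nat \<Rightarrow> ((complex, 'n::finite option) vec \<Rightarrow> complex) \<Rightarrow> 'n option \<Rightarrow>
      (complex, 'n) vec \<Rightarrow> (complex, 'n) vec" where
  "chern_nabla m s i z =
    (\<chi> k. wirtinger (\<lambda>w. s (affine_vec i w)) z k
          - s (affine_vec i z) * wirtinger (\<lambda>w. of_real (fs_potential m i w)) z k)"

definition section_critical_point ::
    "nat \<Rightarrow> ((complex, 'n::finite option) vec \<Rightarrow> complex) \<Rightarrow> 'n cpn \<Rightarrow> bool" where
  "section_critical_point m s p \<longleftrightarrow> (\<forall>i z. affine_pt i z = p \<longrightarrow> chern_nabla m s i z = 0)"

text \<open>The real Hessian in the coordinates of a chart, as a bilinear form in \<open>v\<close>, \<open>w\<close>.\<close>

definition hessian ::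
    "('a::real_normed_vector \<Rightarrow> real) \<Rightarrow> 'a \<Rightarrow> 'a \<Rightarrow> 'a \<Rightarrow> real" where
  "hessian g z v w = frechet_derivative (\<lambda>x. frechet_derivative g (at x) v) (at z) w"

text \<open>
  Non-degeneracy refers to \<open>log |s|\<^sup>2\<close>, hence makes sense only off the zero locus:
  a critical point at which \<open>s\<close> vanishes does not count as non-degenerate.
\<close>

definition nondegenerate_section_critical_point ::
    "nat \<Rightarrow> ((complex, 'n::finite option) vec \<Rightarrow> complex) \<Rightarrow> 'n cpn \<Rightarrow> bool" where
  "nondegenerate_section_critical_point m s p \<longleftrightarrow>
    section_critical_point m s p \<and> fs_norm2 m s p \<noteq> 0 \<and>
    (\<forall>i z. affine_pt i z = p \<longrightarrow>
      (\<forall>v. (\<forall>w. hessian (\<lambda>x. ln (fs_norm2 m s (affine_pt i x))) z v w = 0) \<longrightarrow> v = 0))"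


section \<open>Generalized Morse functions\<close>

primrec Ck_on ::
    "nat \<Rightarrow> 'a::euclidean_space set \<Rightarrow> ('a \<Rightarrow> 'b::real_normed_vector) \<Rightarrow> bool" where
  "Ck_on 0 = (\<lambda>S f. continuous_on S f)"
| "Ck_on (Suc k) = (\<lambda>S f. (\<forall>x\<in>S. f differentiable (at x)) \<and>
      (\<forall>b\<in>Basis. Ck_on k S (\<lambda>x. frechet_derivative f (at x) b)))"

text \<open>Intended for open \<open>S\<close> only.\<close>

definition smooth_on ::
    "'a::euclidean_space set \<Rightarrow> ('a \<Rightarrow> 'b::real_normed_vector) \<Rightarrow> bool" where
  "smooth_on S f \<longleftrightarrow> (\<forall>k. Ck_on k S f)"

definition diffeo_onto_image ::
    "'a::euclidean_space set \<Rightarrow> ('a \<Rightarrow> 'a) \<Rightarrow> bool" where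
  "diffeo_onto_image V \<Phi> \<longleftrightarrow> open V \<and> open (\<Phi> ` V) \<and> inj_on \<Phi> V \<and>
    smooth_on V \<Phi> \<and> smooth_on (\<Phi> ` V) (inv_into V \<Phi>)"

definition smooth_function :: "('n::finite cpn \<Rightarrow> real) \<Rightarrow> bool" where
  "smooth_function f \<longleftrightarrow> (\<forall>i. smooth_on UNIV (\<lambda>z. f (affine_pt i z)))"

definition critical_set :: "('n::finite cpn \<Rightarrow> real) \<Rightarrow> 'n cpn set" where
  "critical_set f = {p. \<forall>i z. affine_pt i z = p \<longrightarrow>
      ((\<lambda>x. f (affine_pt i x)) has_derivative (\<lambda>_. 0)) (at z)}"

text \<open>Embedded submanifolds, by slice charts; the subspace \<open>L\<close> is a real subspace.\<close>

definition submanifold :: "'n::finite cpn set \<Rightarrow> bool" where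
  "submanifold N \<longleftrightarrow> (\<forall>i z. affine_pt i z \<in> N \<longrightarrow>
    (\<exists>V \<Phi> L. z \<in> V \<and> diffeo_onto_image V \<Phi> \<and> subspace L \<and>
      \<Phi> ` (V \<inter> affine_pt i -` N) = \<Phi> ` V \<inter> L))"

text \<open>The tangent space at \<open>affine_pt i z\<close> in the chart \<open>i\<close>: velocities of curves in \<open>N\<close>.\<close>

definition tangent_space ::
    "'n::finite cpn set \<Rightarrow> 'n option \<Rightarrow> (complex, 'n) vec \<Rightarrow> (complex, 'n) vec set" where
  "tangent_space N i z =
    {v. \<exists>\<gamma> :: real \<Rightarrow> (complex, 'n) vec. \<gamma> 0 = z \<and>
      (\<forall>\<^sub>F t in nhds 0. affine_pt i (\<gamma> t) \<in> N) \<and>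
      (\<gamma> has_vector_derivative v) (at 0)}"

text \<open>
  Along \<open>N\<close> the Hessian descends to the normal space \<open>T M / T N\<close>; it is non-degenerate
  there if only the class of \<open>0\<close>, that is only \<open>v\<close> tangent to \<open>N\<close>, lies in its kernel.
\<close>

definition nondegenerate_critical_manifold ::
    "('n::finite cpn \<Rightarrow> real) \<Rightarrow> 'n cpn set \<Rightarrow> bool" where
  "nondegenerate_critical_manifold f N \<longleftrightarrow>
    N \<noteq> {} \<and> connected N \<and> submanifold N \<and> N \<subseteq> critical_set f \<and>
    (\<forall>i z. affine_pt i z \<in> N \<longrightarrow>
      (\<forall>v. (\<forall>w. hessian (\<lambda>x. f (affine_pt i x)) z v w = 0) \<longrightarrow> v \<in> tangent_space N i z))"

definition generalized_morse :: "('n::finite cpn \<Rightarrow> real) \<Rightarrow> bool" where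
  "generalized_morse f \<longleftrightarrow> smooth_function f \<and>
    (\<exists>\<N>. disjoint \<N> \<and> \<Union>\<N> = critical_set f \<and>
      (\<forall>N\<in>\<N>. nondegenerate_critical_manifold f N))"

end

theory Submission
  imports Defs
begin

text \<open>
  Everything happens in the affine charts.  There a section is a polynomial \<open>f\<close>, and \<open>\<nabla>s\<close> has the
  coefficients \<open>F\<^sub>k = \<partial>\<^sub>k f - f m cnj z\<^sub>k / (1 + |z|\<^sup>2)\<close>: linear in the section, smooth but not holomorphic
  in \<open>z\<close>.  Call a section degenerate if in some chart there is a \<open>z\<close> with \<open>F z = 0\<close> where moreover
  \<open>f z = 0\<close> or the real derivative of \<open>F\<close> has a kernel.  The exceptional set \<open>E\<close> consists of the
  degenerate sections.

  \<^emph>\<open>\<open>E\<close> is a null set.\<close>  This is parametric transversality, made explicit.  In the chart \<open>{Z\<^sub>i \<noteq> 0}\<close> vary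
  a section by \<open>Z\<^sub>i\<^sup>m\<^sup>-\<^sup>1 \<ell>(Z)\<close> with \<open>\<ell>\<close> a linear form; this is where \<open>m \<ge> 1\<close> enters.  For every
  point \<open>z\<close> and every number \<open>b\<close> exactly one member of this family has a critical point at \<open>z\<close> and the
  value \<open>b\<close> there, and its \<open>\<ell>\<close> is an explicit smooth function of \<open>(b, z)\<close>
  (\<open>critical_pencil\<close>), between spaces of the same complex dimension \<open>n + 1\<close>.
  At a degenerate zero of \<open>F\<close> either \<open>b = 0\<close>, or this function has a singular
  derivative (\<open>critical_pencil_singular\<close>).  So the degenerate members of the family lie in the
  union of the image of a hyperplane and the critical values, and
  these are negligible, the latter by Sard's theorem (\<open>Sard_equidimensional\<close>).  Fubini
  (\<open>null_PiM_if_null_slices\<close>) extends this from the family to all coefficients; the measurability that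
  Fubini asks for comes from writing degeneracy as the existence of a zero of a continuous
  function on a countable union of compact sets (\<open>sets_Collect_compact_zero\<close>).

  \<^emph>\<open>Outside of \<open>E\<close> all critical points are nondegenerate and isolated.\<close>  Such a point is a
  zero of \<open>F\<close> with injective derivative, hence an isolated zero.  The derivative
  of \<open>|s|\<^sup>2\<close> in direction \<open>v\<close> is \<open>2 Re (cnj f \<Sum> v\<^sub>k F\<^sub>k) / (1 + |z|\<^sup>2)\<^sup>m\<close>, so where \<open>F = 0\<close> and \<open>f \<noteq> 0\<close> the Hessian
  of \<open>|s|\<^sup>2\<close>, and up to the factor \<open>|s|\<^sup>2\<close> also that of \<open>log |s|\<^sup>2\<close>, is the perfect
  pairing \<open>Re (cnj f \<Sum> v\<^sub>k y\<^sub>k)\<close> with \<open>y\<close> the derivative of \<open>F\<close> in direction \<open>w\<close>.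

  \<^emph>\<open>Outside of \<open>E\<close> the function \<open>|s|\<^sup>2\<close> is generalized Morse.\<close>  Its critical set consists of the
  critical points of \<open>s\<close> and the zero locus, which are disjoint.  On the zero locus \<open>F = \<partial>f\<close>
  does not vanish, so \<open>f\<close> can replace one of the coordinates
  (\<open>slice_chart_exists\<close>), and the zero locus is a submanifold.  There the Hessian, evaluated on
  \<open>(v, v)\<close>, is a positive multiple of \<open>|df(v)|\<^sup>2\<close>, so its kernel is the tangent space.
  The critical manifolds are the singletons of critical points and the connected components of the
  zero locus.
\<close>

section \<open>Sard's theorem between Euclidean spaces of equal dimension\<close>

text \<open>
  \<open>baby_Sard\<close> concerns \<open>real ^ 'm\<close> with a well-ordered index type, whereas the type \<open>'n option\<close> of
  homogeneous coordinates carries no order.  An initial segment of \<open>nat\<close> of length \<open>DIM('a)\<close>, turned into a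
  type, is an index type to which every Euclidean space can be compared.
\<close>

typedef (overloaded) ('a::euclidean_space) coord_index = "{..<DIM('a)} :: nat set"
proof
  show "0 \<in> {..<DIM('a)}" by simp
qed

instantiation coord_index :: (euclidean_space) "{finite, wellorder}"
begin

definition less_eq_coord_index :: "'a coord_index \<Rightarrow> 'a coord_index \<Rightarrow> bool" where
  "less_eq_coord_index i j \<longleftrightarrow> Rep_coord_index i \<le> Rep_coord_index j"

definition less_coord_index :: "'a coord_index \<Rightarrow> 'a coord_index \<Rightarrow> bool" where
  "less_coord_index i j \<longleftrightarrow> Rep_coord_index i < Rep_coord_index j"

instance
proof
  fix P :: "'a coord_index \<Rightarrow> bool" and a
  assume step: "\<And>x. (\<And>y. y < x \<Longrightarrow> P y) \<Longrightarrow> P x"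
  show "P a"
    by (induction a rule: measure_induct_rule[of Rep_coord_index])
       (auto intro: step simp: less_coord_index_def)
next
  have "range (Rep_coord_index :: 'a coord_index \<Rightarrow> nat) = {..<DIM('a)}"
    using type_definition.Rep_range[OF type_definition_coord_index] .
  then show "finite (UNIV :: 'a coord_index set)"
    by (metis Rep_coord_index_inject finite_imageD finite_lessThan inj_onI)
qed (auto simp: less_eq_coord_index_def less_coord_index_def Rep_coord_index_inject)

end

lemma card_coord_index: "CARD('a::euclidean_space coord_index) = DIM('a)"
  using type_definition.card[OF type_definition_coord_index] by simp

lemma Sard_equidimensional:
  fixes f :: "'a::euclidean_space \<Rightarrow> 'b::euclidean_space"
  assumes dim: "DIM('a) = DIM('b)"
    and der: "\<And>x. x \<in> S \<Longrightarrow> (f has_derivative f' x) (at x)"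
    and sing: "\<And>x. x \<in> S \<Longrightarrow> \<not> inj (f' x)"
  shows "negligible (f ` S)"
proof -
  obtain p :: "'a \<Rightarrow> real ^ 'a coord_index" and p' where p: "linear p" "linear p'"
      "\<And>x. p' (p x) = x" "\<And>x. p (p' x) = x"
    by (rule isomorphisms_UNIV_UNIV[where 'M = 'a and 'N = "real ^ 'a coord_index"])
       (auto simp: card_coord_index)
  obtain q :: "'b \<Rightarrow> real ^ 'a coord_index" and q' where q: "linear q" "linear q'"
      "\<And>x. q' (q x) = x" "\<And>x. q (q' x) = x"
    by (rule isomorphisms_UNIV_UNIV[where 'M = 'b and 'N = "real ^ 'a coord_index"])
       (auto simp: card_coord_index dim)
  have bl: "bounded_linear q" "bounded_linear p'"
    using p q by (simp_all add: linear_conv_bounded_linear)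
  let ?h = "\<lambda>y. q (f (p' y))" and ?h' = "\<lambda>y v. q (f' (p' y) (p' v))"
  have der_h: "(?h has_derivative ?h' y) (at y)" if "y \<in> p ` S" for y
  proof -
    have "p' y \<in> S" using that p by auto
    have "(p' has_derivative p') (at y)"
      by (rule bounded_linear_imp_has_derivative[OF bl(2)])
    from diff_chain_at[OF this der[OF \<open>p' y \<in> S\<close>]]
    have "((\<lambda>y. f (p' y)) has_derivative (\<lambda>v. f' (p' y) (p' v))) (at y)"
      by (simp add: o_def)
    from bounded_linear.has_derivative[OF bl(1) this] show ?thesis .
  qed
  have "negligible (?h ` p ` S)"
  proof (rule baby_Sard)
    fix y assume y: "y \<in> p ` S"
    show "(?h has_derivative ?h' y) (at y within p ` S)"
      using der_h[OF y] by (rule has_derivative_at_withinI)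
    have lin: "linear (?h' y)"
      using der_h[OF y] by (rule has_derivative_linear)
    have "p' y \<in> S" using y p by auto
    with sing obtain u v where uv: "u \<noteq> v" "f' (p' y) u = f' (p' y) v"
      unfolding inj_def by blast
    have "\<not> inj (?h' y)"
    proof
      assume "inj (?h' y)"
      moreover have "?h' y (p u) = ?h' y (p v)" using uv p by simp
      ultimately have "p u = p v" by (rule injD)
      then show False using uv p by metis
    qed
    moreover have "(*v) (matrix (?h' y)) = ?h' y"
      using lin by (intro ext) (simp add: matrix_works)
    ultimately show "rank (matrix (?h' y)) < CARD('a coord_index)"
      by (simp add: less_rank_noninjective)
  qed simp
  then have "negligible (q' ` (?h ` p ` S))"
    by (rule negligible_differentiable_image_negligible[rotated])
       (auto simp: dim card_coord_index intro!: linear_imp_differentiable_on q)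
  moreover have "q' ` (?h ` p ` S) = f ` S"
    using p q by (simp add: image_image)
  ultimately show ?thesis by simp
qed

section \<open>Null sets and measurable projections in coefficient space\<close>

lemma lborel_complex_sigma_finite:
  "product_sigma_finite (\<lambda>_::'i. lborel :: complex measure)"
  by standard

lemma borel_measurable_vec_lambda:
  fixes f :: "'a \<Rightarrow> 'k::finite \<Rightarrow> complex"
  assumes "\<And>k. (\<lambda>x. f x k) \<in> borel_measurable M"
  shows "(\<lambda>x. \<chi> k. f x k) \<in> borel_measurable M"
proof (subst borel_measurable_euclidean_space, rule ballI)
  fix b :: "(complex, 'k) vec"
  assume "b \<in> Basis"
  then obtain k u where b: "b = axis k u"
    by (auto simp: Basis_vec_def)
  show "(\<lambda>x. (\<chi> k. f x k) \<bullet> b) \<in> borel_measurable M"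
    using assms[of k] by (simp add: b inner_axis borel_measurable_inner)
qed

lemma measurable_vec_of_coords:
  fixes idx :: "'k::finite \<Rightarrow> 'i"
  shows "(\<lambda>x. (\<chi> k. x (idx k)) :: (complex, 'k) vec)
      \<in> borel_measurable (PiM (range idx) (\<lambda>_. lborel :: complex measure))"
proof (rule borel_measurable_vec_lambda)
  fix k
  show "(\<lambda>x. x (idx k)) \<in> borel_measurable (PiM (range idx) (\<lambda>_. lborel :: complex measure))"
    using measurable_component_singleton[of "idx k" "range idx" "\<lambda>_. lborel :: complex measure"]
    by simp
qed

lemma prod_Basis_vec:
  fixes h :: "(complex, 'k::finite) vec \<Rightarrow> real"
  shows "(\<Prod>b\<in>Basis. h b) = (\<Prod>k\<in>UNIV. \<Prod>u\<in>Basis. h (axis k u))"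
proof -
  have "(\<Prod>k\<in>UNIV. \<Prod>u\<in>Basis. h (axis k u))
      = (\<Prod>p\<in>UNIV \<times> Basis. h (axis (fst p) (snd p)))"
    by (simp add: prod.cartesian_product case_prod_beta)
  also have "\<dots> = (\<Prod>b\<in>Basis. h b)"
  proof (rule prod.reindex_bij_betw)
    show "bij_betw (\<lambda>p. axis (fst p) (snd p)) (UNIV \<times> Basis)
        (Basis :: (complex, 'k) vec set)"
      unfolding bij_betw_def
    proof
      show "inj_on (\<lambda>p. axis (fst p) (snd p)) ((UNIV :: 'k set) \<times> (Basis :: complex set))"
      proof (rule inj_onI)
        fix p q :: "'k \<times> complex"
        assume "p \<in> UNIV \<times> Basis" "q \<in> UNIV \<times> Basis" "axis (fst p) (snd p) = axis (fst q) (snd q)"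
        moreover then have "snd p \<noteq> 0" by auto
        ultimately show "p = q"
          by (auto simp: axis_eq_axis prod_eq_iff)
      qed
      show "(\<lambda>p. axis (fst p) (snd p)) ` ((UNIV :: 'k set) \<times> Basis) = (Basis :: (complex, 'k) vec set)"
      proof (intro subset_antisym subsetI)
        fix b :: "(complex, 'k) vec"
        assume "b \<in> Basis"
        then obtain k u where "b = axis k u" "u \<in> Basis"
          by (auto simp: Basis_vec_def)
        then show "b \<in> (\<lambda>p. axis (fst p) (snd p)) ` (UNIV \<times> Basis)"
          by (intro image_eqI[of _ _ "(k, u)"]) auto
      qed auto
    qed
  qed
  finally show ?thesis by simp
qed

text \<open>
  Selecting coordinates identifies a finite product of copies of Lebesgue measure on \<open>complex\<close> with
  Lebesgue measure on vectors.  This carries negligible sets, the output of Sard's theorem, over to the product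
  measure on coefficients.
\<close>

lemma distr_PiM_lborel_vec:
  fixes idx :: "'k::finite \<Rightarrow> 'i"
  assumes inj: "inj idx"
  shows "distr (PiM (range idx) (\<lambda>_. lborel :: complex measure)) borel (\<lambda>x. \<chi> k. x (idx k))
    = (lborel :: (complex, 'k) vec measure)"
proof (rule lborel_eqI[symmetric])
  let ?P = "PiM (range idx) (\<lambda>_. lborel :: complex measure)"
  interpret product_sigma_finite "\<lambda>_::'i. lborel :: complex measure"
    by (rule lborel_complex_sigma_finite)
  fix l u :: "(complex, 'k) vec"
  assume le: "\<And>b. b \<in> Basis \<Longrightarrow> l \<bullet> b \<le> u \<bullet> b"
  have le': "l $ k \<bullet> b \<le> u $ k \<bullet> b" if "b \<in> Basis" for k b
    using le[of "axis k b"] that by (auto simp: inner_axis Basis_vec_def)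
  let ?B = "\<lambda>i. box (l $ inv idx i) (u $ inv idx i)"
  have "(\<lambda>x. \<chi> k. x (idx k)) -` box l u \<inter> space ?P = PiE (range idx) ?B"
    using inj by (auto simp: space_PiM PiE_iff mem_box Basis_vec_def inner_axis inv_f_f)
  then have "emeasure (distr ?P borel (\<lambda>x. \<chi> k. x (idx k))) (box l u)
      = emeasure ?P (PiE (range idx) ?B)"
    by (simp add: emeasure_distr measurable_vec_of_coords)
  also have "\<dots> = (\<Prod>i\<in>range idx. emeasure lborel (?B i))"
    by (rule emeasure_PiM) auto
  also have "\<dots> = (\<Prod>k\<in>UNIV. emeasure lborel (box (l $ k) (u $ k)))"
    using inj by (simp add: prod.reindex inv_f_f)
  also have "\<dots> = (\<Prod>k\<in>UNIV. ennreal (\<Prod>b\<in>Basis. (u $ k - l $ k) \<bullet> b))"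
    using le' by (intro prod.cong refl emeasure_lborel_box) auto
  also have "\<dots> = ennreal (\<Prod>k\<in>UNIV. \<Prod>b\<in>Basis. (u $ k - l $ k) \<bullet> b)"
    using le' by (intro prod_ennreal prod_nonneg) (auto simp: inner_diff_left)
  also have "\<dots> = ennreal (\<Prod>b\<in>Basis. (u - l) \<bullet> b)"
    by (simp add: prod_Basis_vec inner_axis)
  finally show "emeasure (distr ?P borel (\<lambda>x. \<chi> k. x (idx k))) (box l u)
      = (\<Prod>b\<in>Basis. (u - l) \<bullet> b)" .
qed simp

text \<open>
  Fubini: freeze the coordinates outside of the range of \<open>idx\<close> at the values of \<open>y\<close>.
\<close>

lemma null_PiM_if_null_slices:
  fixes idx :: "'k::finite \<Rightarrow> 'i" and B :: "('i \<Rightarrow> complex) set"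
  assumes inj: "inj idx" and J: "finite J" "range idx \<subseteq> J"
    and B: "B \<in> sets (PiM J (\<lambda>_. lborel))"
    and slice: "\<And>y. negligible
      {X :: (complex, 'k) vec. (\<lambda>i. if i \<in> range idx then X $ inv idx i else y i) \<in> B}"
  shows "B \<in> null_sets (PiM J (\<lambda>_. lborel))"
proof (rule null_setsI)
  interpret product_sigma_finite "\<lambda>_::'i. lborel :: complex measure"
    by (rule lborel_complex_sigma_finite)
  let ?I = "range idx" and ?K = "J - range idx" and ?M = "\<lambda>_::'i. lborel :: complex measure"
  have J_eq: "J = ?K \<union> ?I" using J by auto
  \<comment> \<open>Off \<open>J\<close> the points of the product space have the value \<open>undefined\<close>, as \<open>merge\<close> does.\<close>
  have zero: "(\<integral>\<^sup>+x. indicator B (merge ?K ?I (y, x)) \<partial>PiM ?I ?M) = 0" for y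
  proof -
    let ?S = "{X :: (complex, 'k) vec. (\<lambda>i. if i \<in> ?I then X $ inv idx i else
      (if i \<in> ?K then y i else undefined)) \<in> B}"
    have "?S \<in> null_sets (completion lborel)"
      using slice[of "\<lambda>i. if i \<in> ?K then y i else undefined"] by (simp add: negligible_iff_null_sets)
    then obtain N where N: "N \<in> null_sets lborel" "?S \<subseteq> N"
      by (auto simp: null_sets_completion_iff2)
    let ?N = "(\<lambda>x. (\<chi> k. x (idx k)) :: (complex, 'k) vec) -` N \<inter> space (PiM ?I ?M)"
    have N_null: "?N \<in> null_sets (PiM ?I ?M)"
    proof (rule null_setsI)
      show "?N \<in> sets (PiM ?I ?M)"
        using N by (intro measurable_sets[OF measurable_vec_of_coords]) auto
      have "emeasure (PiM ?I ?M) ?N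
          = emeasure (distr (PiM ?I ?M) borel (\<lambda>x. (\<chi> k. x (idx k)) :: (complex, 'k) vec)) N"
        using N by (subst emeasure_distr) (auto simp: measurable_vec_of_coords)
      also have "\<dots> = 0"
        using N by (simp add: distr_PiM_lborel_vec[OF inj] null_setsD1)
      finally show "emeasure (PiM ?I ?M) ?N = 0" .
    qed
    have "AE x in PiM ?I ?M. indicator B (merge ?K ?I (y, x)) = (0::ennreal)"
    proof (rule AE_I'[OF N_null], rule subsetI)
      fix x assume x: "x \<in> {x \<in> space (PiM ?I ?M). indicator B (merge ?K ?I (y, x)) \<noteq> (0::ennreal)}"
      have "(\<lambda>i. if i \<in> ?I then (\<chi> k. x (idx k)) $ inv idx i else
          (if i \<in> ?K then y i else undefined)) = merge ?K ?I (y, x)"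
        using inj by (auto simp: merge_def fun_eq_iff inv_f_f)
      with x have "(\<chi> k. x (idx k)) \<in> ?S"
        by (simp add: indicator_def split: if_splits)
      with N x show "x \<in> ?N" by auto
    qed
    from nn_integral_cong_AE[OF this] show ?thesis by simp
  qed
  have "emeasure (PiM J ?M) B = (\<integral>\<^sup>+x. indicator B x \<partial>PiM (?K \<union> ?I) ?M)"
    using B J_eq by (metis nn_integral_indicator)
  also have "\<dots> = (\<integral>\<^sup>+y. \<integral>\<^sup>+x. indicator B (merge ?K ?I (y, x)) \<partial>PiM ?I ?M \<partial>PiM ?K ?M)"
    using J B J_eq by (intro product_nn_integral_fold) (auto intro: borel_measurable_indicator)
  also have "\<dots> = 0" by (simp add: zero)
  finally show "emeasure (PiM J ?M) B = 0" .
qed (rule B)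

text \<open>
  A projection along a compact set is measurable because it can be tested on a countable dense subset:
  by compactness, a continuous function has a zero iff it takes arbitrarily small values on that subset.
\<close>

lemma sets_Collect_compact_zero:
  fixes H :: "'c \<Rightarrow> 'a::euclidean_space \<Rightarrow> real"
  assumes "compact K"
    and meas: "\<And>x. x \<in> K \<Longrightarrow> (\<lambda>c. H c x) \<in> borel_measurable M"
    and cont: "\<And>c. c \<in> space M \<Longrightarrow> continuous_on K (H c)"
  shows "{c \<in> space M. \<exists>x\<in>K. H c x = 0} \<in> sets M"
proof -
  obtain D where D: "countable D" "D \<subseteq> K" "K \<subseteq> closure D"
    by (rule separable)
  have "(\<exists>x\<in>K. H c x = 0) \<longleftrightarrow> (\<forall>n. \<exists>x\<in>D. \<bar>H c x\<bar> < 1 / real (Suc n))" if c: "c \<in> space M" for c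
  proof
    assume "\<exists>x\<in>K. H c x = 0"
    then obtain x where x: "x \<in> K" "H c x = 0" by blast
    show "\<forall>n. \<exists>x\<in>D. \<bar>H c x\<bar> < 1 / real (Suc n)"
    proof
      fix n
      obtain d where d: "d > 0" "\<And>y. y \<in> K \<Longrightarrow> dist y x < d \<Longrightarrow> dist (H c y) (H c x) < 1 / real (Suc n)"
        using cont[OF c] x(1) unfolding continuous_on_iff
        by (metis divide_pos_pos of_nat_0_less_iff zero_less_Suc zero_less_one)
      obtain y where "y \<in> D" "dist y x < d"
        using D(3) x(1) d(1) unfolding closure_approachable subset_iff by blast
      with d(2)[of y] D(2) x(2) show "\<exists>x\<in>D. \<bar>H c x\<bar> < 1 / real (Suc n)"
        by (auto simp: dist_real_def)
    qed
  next
    assume "\<forall>n. \<exists>x\<in>D. \<bar>H c x\<bar> < 1 / real (Suc n)"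
    then obtain y where y: "\<And>n. y n \<in> D" "\<And>n. \<bar>H c (y n)\<bar> < 1 / real (Suc n)"
      by metis
    then obtain l r where l: "l \<in> K" "strict_mono r" "(y \<circ> r) \<longlonglongrightarrow> l"
      using \<open>compact K\<close> D(2) unfolding compact_def by (metis subsetD)
    have "(\<lambda>n. H c (y (r n))) \<longlonglongrightarrow> H c l"
      by (rule continuous_on_tendsto_compose[OF cont[OF c] l(3)[unfolded o_def] l(1)])
         (use y(1) D(2) in \<open>auto intro!: always_eventually\<close>)
    moreover have "(\<lambda>n. H c (y n)) \<longlonglongrightarrow> 0"
      using y(2) by (intro Lim_null_comparison[OF _ LIMSEQ_Suc[OF lim_1_over_n]])
        (auto intro!: always_eventually less_imp_le)
    then have "(\<lambda>n. H c (y (r n))) \<longlonglongrightarrow> 0"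
      using LIMSEQ_subseq_LIMSEQ[OF _ l(2)] by (fastforce simp: o_def)
    ultimately have "H c l = 0" by (rule LIMSEQ_unique)
    with l(1) show "\<exists>x\<in>K. H c x = 0" by blast
  qed
  then have "{c \<in> space M. \<exists>x\<in>K. H c x = 0}
      = {c \<in> space M. \<forall>n. \<exists>x\<in>D. \<bar>H c x\<bar> < 1 / real (Suc n)}" by blast
  also have "\<dots> \<in> sets M"
  proof -
    have "{c \<in> space M. \<bar>H c x\<bar> < 1 / real (Suc n)} \<in> sets M" if "x \<in> D" for n x
    proof -
      have [measurable]: "(\<lambda>c. H c x) \<in> borel_measurable M" using meas D(2) that by auto
      show ?thesis by measurable
    qed
    then have "{c \<in> space M. \<exists>x\<in>D. \<bar>H c x\<bar> < 1 / real (Suc n)} \<in> sets M" for n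
      by (intro sets.sets_Collect_countable_Ex' D(1))
    then show ?thesis by (rule sets.sets_Collect_countable_All)
  qed
  finally show ?thesis .
qed

section \<open>Polynomials in affine coordinates\<close>

text \<open>
  Polynomial functions, given by how they are built: the calculus below and the smoothness of
  compositions are then proved by rule induction.
\<close>

inductive cpoly :: "((complex, 'n::finite) vec \<Rightarrow> complex) \<Rightarrow> bool" where
  cpoly_const: "cpoly (\<lambda>_. c)"
| cpoly_coord: "cpoly (\<lambda>z. z $ k)"
| cpoly_add: "cpoly f \<Longrightarrow> cpoly g \<Longrightarrow> cpoly (\<lambda>z. f z + g z)"
| cpoly_mult: "cpoly f \<Longrightarrow> cpoly g \<Longrightarrow> cpoly (\<lambda>z. f z * g z)"

lemma cpoly_sum: "(\<And>a. a \<in> A \<Longrightarrow> cpoly (f a)) \<Longrightarrow> cpoly (\<lambda>z. \<Sum>a\<in>A. f a z)"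
  by (induction A rule: infinite_finite_induct) (auto intro: cpoly.intros)

lemma cpoly_power: "cpoly f \<Longrightarrow> cpoly (\<lambda>z. f z ^ d)"
  by (induction d) (auto intro: cpoly.intros)

lemma cpoly_prod: "(\<And>a. a \<in> A \<Longrightarrow> cpoly (f a)) \<Longrightarrow> cpoly (\<lambda>z. \<Prod>a\<in>A. f a z)"
  by (induction A rule: infinite_finite_induct) (auto intro: cpoly.intros)

lemma has_derivative_vec_nth [derivative_intros]:
  "(f has_derivative f') F \<Longrightarrow> ((\<lambda>x. f x $ k) has_derivative (\<lambda>v. f' v $ k)) F"
  by (rule bounded_linear.has_derivative[OF bounded_linear_vec_nth])

lemma cpoly_complex_derivative:
  assumes "cpoly f"
  shows "\<exists>f'. (\<forall>k. cpoly (f' k)) \<and>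
    (\<forall>z. (f has_derivative (\<lambda>v. \<Sum>k\<in>UNIV. v $ k * f' k z)) (at z))"
  using assms
proof induction
  case (cpoly_const c)
  show ?case by (rule exI[of _ "\<lambda>_ _. 0"]) (auto intro: cpoly.cpoly_const)
next
  case (cpoly_coord k)
  have "((\<lambda>z. z $ k) has_derivative (\<lambda>v. \<Sum>j\<in>UNIV. v $ j * (if j = k then 1 else 0))) (at z)"
    for z :: "(complex, 'a) vec"
  proof -
    have "((\<lambda>z. z $ k) has_derivative (\<lambda>v. v $ k)) (at z)"
      by (auto intro!: derivative_eq_intros)
    then show ?thesis by (simp add: if_distrib cong: if_cong)
  qed
  then show ?case
    by (intro exI[of _ "\<lambda>j _. if j = k then 1 else 0"]) (auto intro: cpoly.cpoly_const)
next
  case (cpoly_add f g)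
  then obtain f' g' where d: "\<And>k. cpoly (f' k)" "\<And>k. cpoly (g' k)"
      "\<And>z. (f has_derivative (\<lambda>v. \<Sum>k\<in>UNIV. v $ k * f' k z)) (at z)"
      "\<And>z. (g has_derivative (\<lambda>v. \<Sum>k\<in>UNIV. v $ k * g' k z)) (at z)"
    by blast
  have "((\<lambda>z. f z + g z) has_derivative (\<lambda>v. \<Sum>k\<in>UNIV. v $ k * (f' k z + g' k z))) (at z)" for z
    using has_derivative_add[OF d(3)[of z] d(4)[of z]] by (simp add: algebra_simps sum.distrib)
  then show ?case
    using d by (intro exI[of _ "\<lambda>k z. f' k z + g' k z"]) (auto intro: cpoly.cpoly_add)
next
  case (cpoly_mult f g)
  then obtain f' g' where d: "\<And>k. cpoly (f' k)" "\<And>k. cpoly (g' k)"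
      "\<And>z. (f has_derivative (\<lambda>v. \<Sum>k\<in>UNIV. v $ k * f' k z)) (at z)"
      "\<And>z. (g has_derivative (\<lambda>v. \<Sum>k\<in>UNIV. v $ k * g' k z)) (at z)"
    by blast
  have "((\<lambda>z. f z * g z) has_derivative
      (\<lambda>v. \<Sum>k\<in>UNIV. v $ k * (f z * g' k z + f' k z * g z))) (at z)" for z
    using has_derivative_mult[OF d(3)[of z] d(4)[of z]]
    by (simp add: algebra_simps sum.distrib sum_distrib_left)
  then show ?case
    using d cpoly_mult.hyps
    by (intro exI[of _ "\<lambda>k z. f z * g' k z + f' k z * g z"])
       (auto intro!: cpoly.cpoly_add[OF cpoly.cpoly_mult cpoly.cpoly_mult])
qed

lemma sum_axis:
  fixes d :: "'n::finite \<Rightarrow> complex"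
  shows "(\<Sum>j\<in>UNIV. axis k c $ j * d j) = c * d k"
proof -
  have "(\<Sum>j\<in>UNIV. axis k c $ j * d j) = (\<Sum>j\<in>UNIV. if j = k then c * d j else 0)"
    by (rule sum.cong) (auto simp: axis_def)
  then show ?thesis by simp
qed

lemma wirtinger_complex_linear:
  assumes "(f has_derivative (\<lambda>v. \<Sum>k\<in>UNIV. v $ k * d k)) (at z)"
  shows "wirtinger f z k = d k"
  by (simp add: wirtinger_def sum_axis frechet_derivative_at[OF assms, symmetric])

text \<open>
  The derivative of a polynomial is complex linear, hence given by the \<open>wirtinger\<close> derivatives alone, and these
  are again polynomials, so that the statement can be iterated.
\<close>

lemma cpoly_wirtinger_derivative:
  assumes "cpoly f"
  shows cpoly_wirtinger: "cpoly (\<lambda>z. wirtinger f z k)"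
    and cpoly_has_derivative:
      "(f has_derivative (\<lambda>v. \<Sum>k\<in>UNIV. v $ k * wirtinger f z k)) (at z)"
proof -
  obtain f' where f': "\<And>k. cpoly (f' k)"
      "\<And>z. (f has_derivative (\<lambda>v. \<Sum>k\<in>UNIV. v $ k * f' k z)) (at z)"
    using cpoly_complex_derivative[OF assms] by blast
  have "(\<lambda>z. wirtinger f z k) = f' k" for k
    using wirtinger_complex_linear[OF f'(2)] by blast
  with f' show "cpoly (\<lambda>z. wirtinger f z k)"
      "(f has_derivative (\<lambda>v. \<Sum>k\<in>UNIV. v $ k * wirtinger f z k)) (at z)"
    by (simp_all add: wirtinger_complex_linear[OF f'(2)])
qed

lemma cpoly_differentiable: "cpoly f \<Longrightarrow> f differentiable (at z)"
  using cpoly_has_derivative differentiable_def by blast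

lemma cpoly_continuous: "cpoly f \<Longrightarrow> continuous_on S f"
  by (intro continuous_at_imp_continuous_on ballI has_derivative_continuous[OF cpoly_has_derivative])

lemma wirtinger_add:
  "cpoly f \<Longrightarrow> cpoly g \<Longrightarrow> wirtinger (\<lambda>z. f z + g z) z k = wirtinger f z k + wirtinger g z k"
  using has_derivative_add[OF cpoly_has_derivative cpoly_has_derivative, of f g z]
  by (intro wirtinger_complex_linear) (simp add: algebra_simps sum.distrib)

lemma wirtinger_cmult: "cpoly f \<Longrightarrow> wirtinger (\<lambda>z. c * f z) z k = c * wirtinger f z k"
  using has_derivative_mult_right[OF cpoly_has_derivative, of f c z]
  by (intro wirtinger_complex_linear) (simp add: algebra_simps sum_distrib_left)

lemma wirtinger_const: "wirtinger (\<lambda>_. c) z k = 0"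
  by (rule wirtinger_complex_linear) auto

lemma wirtinger_sum:
  assumes "\<And>a. a \<in> A \<Longrightarrow> cpoly (f a)"
  shows "wirtinger (\<lambda>z. \<Sum>a\<in>A. f a z) z k = (\<Sum>a\<in>A. wirtinger (f a) z k)"
  using assms
  by (induction A rule: infinite_finite_induct)
     (auto simp: wirtinger_add wirtinger_const cpoly_sum)

lemma wirtinger_coord: "wirtinger (\<lambda>z. z $ j) z k = (if k = j then 1 else 0)"
proof (rule wirtinger_complex_linear)
  have "((\<lambda>z. z $ j) has_derivative (\<lambda>v. v $ j)) (at z)"
    by (auto intro!: derivative_eq_intros)
  then show "((\<lambda>z. z $ j) has_derivative (\<lambda>v. \<Sum>k\<in>UNIV. v $ k * (if k = j then 1 else 0))) (at z)"
    by (simp add: if_distrib cong: if_cong)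
qed

section \<open>Homogeneous vectors in an affine chart\<close>

abbreviation chart_coord :: "'n::finite option \<Rightarrow> 'n \<Rightarrow> 'n option" where
  "chart_coord i k \<equiv> Transposition.transpose None i (Some k)"

text \<open>
  \<open>affine_vec i\<close> with an arbitrary entry \<open>a\<close> in place of \<open>1\<close>, which makes it linear in all its entries; used also
  for coefficient vectors of linear forms.
\<close>

definition chart_vec ::
    "'n::finite option \<Rightarrow> complex \<Rightarrow> (complex, 'n) vec \<Rightarrow> (complex, 'n option) vec" where
  "chart_vec i a y =
    (\<chi> j. case Transposition.transpose None i j of None \<Rightarrow> a | Some k \<Rightarrow> y $ k)"

lemma affine_vec_chart_vec: "affine_vec i z = chart_vec i 1 z"
  by (simp add: affine_vec_def chart_vec_def)

lemma chart_vec_nth [simp]: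
  "chart_vec i a y $ i = a" "chart_vec i a y $ chart_coord i k = y $ k"
  by (simp_all add: chart_vec_def)

lemma chart_index_cases:
  obtains "j = i" | k where "j = chart_coord i k"
proof (cases "Transposition.transpose None i j")
  case None
  then have "j = i" by (metis transpose_apply_first transpose_involutory)
  then show ?thesis using that by blast
next
  case (Some k)
  then have "j = chart_coord i k" by (metis transpose_involutory)
  then show ?thesis using that by blast
qed

lemma chart_vec_eqI:
  "X $ i = a \<Longrightarrow> (\<And>k. X $ chart_coord i k = y $ k) \<Longrightarrow> X = chart_vec i a y"
  unfolding vec_eq_iff by (metis chart_index_cases chart_vec_nth)

lemma sum_chart_index:
  "(\<Sum>j\<in>UNIV. h j) = h i + (\<Sum>k\<in>UNIV. h (chart_coord i k))"
proof -
  have "(\<Sum>j\<in>UNIV. h j) = (\<Sum>j\<in>UNIV. h (Transposition.transpose None i j))"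
    by (rule sum.reindex_bij_betw[symmetric]) (simp add: bij_betw_def)
  then show ?thesis by (simp add: UNIV_option_conv sum.reindex)
qed

lemma bounded_linear_chart_vec: "bounded_linear (\<lambda>p. chart_vec i (fst p) (snd p))"
proof -
  have "linear (\<lambda>p. chart_vec i (fst p) (snd p))"
    by (rule linearI) (auto simp: chart_vec_def vec_eq_iff split: option.split)
  then show ?thesis by (simp add: linear_conv_bounded_linear)
qed

lemma cpoly_affine_vec: "cpoly (\<lambda>z. affine_vec i z $ j)"
  by (rule chart_index_cases[of j i])
     (auto simp: affine_vec_chart_vec intro: cpoly.intros)

lemma cpoly_hom_poly: "cpoly (\<lambda>z. hom_poly m c (affine_vec i z))"
  unfolding hom_poly_def
  by (intro cpoly_sum cpoly_mult cpoly_const cpoly_prod cpoly_power cpoly_affine_vec)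

lemma norm_affine_vec: "(\<Sum>j\<in>UNIV. (cmod (affine_vec i z $ j))\<^sup>2) = 1 + (norm z)\<^sup>2"
  by (subst sum_chart_index[of _ i])
     (simp add: affine_vec_chart_vec norm_vec_def L2_set_def sum_nonneg)

section \<open>The Chern connection in a chart\<close>

text \<open>The coefficients of \<open>\<partial>\<phi>\<close> for \<open>\<phi> = m log (1 + |z|\<^sup>2)\<close>.\<close>

definition fs_form :: "nat \<Rightarrow> (complex, 'n::finite) vec \<Rightarrow> 'n \<Rightarrow> complex" where
  "fs_form m z k = of_nat m * cnj (z $ k) / of_real (1 + (norm z)\<^sup>2)"

definition nabla ::
    "nat \<Rightarrow> ((complex, 'n::finite) vec \<Rightarrow> complex) \<Rightarrow> (complex, 'n) vec \<Rightarrow> (complex, 'n) vec" where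
  "nabla m f z = (\<chi> k. wirtinger f z k - f z * fs_form m z k)"

lemma one_plus_norm_pos: "1 + (norm z)\<^sup>2 > 0" "1 + (norm z)\<^sup>2 \<noteq> 0"
  by (smt (verit) zero_le_power2)+

lemma fs_norm2_affine_pt:
  assumes "\<And>a Z. s (a *s Z) = a ^ m * s Z"
  shows "fs_norm2 m s (affine_pt i z) = (cmod (s (affine_vec i z)))\<^sup>2 / (1 + (norm z)\<^sup>2) ^ m"
  using fs_norm2_abs_cpn[OF assms affine_vec_nonzero]
  by (simp add: affine_pt_def norm_affine_vec)

lemma fs_potential_eq: "fs_potential m i z = of_nat m * ln (1 + (norm z)\<^sup>2)"
  using fs_norm2_affine_pt[of "\<lambda>Z. Z $ i ^ m" m i z] one_plus_norm_pos[of z]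
  by (simp add: fs_potential_def power_mult_distrib ln_div ln_realpow)

lemma has_derivative_norm_sq:
  "((\<lambda>z. 1 + (norm z)\<^sup>2) has_derivative (\<lambda>v. 2 * (z \<bullet> v))) (at (z::'a::real_inner))"
  unfolding power2_norm_eq_inner
  by (auto intro!: derivative_eq_intros simp: inner_commute)

lemma wirtinger_fs_potential: "wirtinger (\<lambda>w. of_real (fs_potential m i w)) z k = fs_form m z k"
proof -
  have "((\<lambda>w. of_real (of_nat m * ln (1 + (norm w)\<^sup>2)) :: complex) has_derivative
      (\<lambda>v. of_real (of_nat m * (2 * (z \<bullet> v) / (1 + (norm z)\<^sup>2))))) (at z)"
    using one_plus_norm_pos[of z]
    by (auto intro!: derivative_eq_intros has_derivative_norm_sq simp: divide_inverse mult_ac)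
  from frechet_derivative_at[OF this]
  have frd: "frechet_derivative (\<lambda>w. of_real (fs_potential m i w) :: complex) (at z) =
      (\<lambda>v. of_real (of_nat m * (2 * (z \<bullet> v) / (1 + (norm z)\<^sup>2))))"
    by (simp add: fs_potential_eq)
  have half: "real m * (2 * a) / (2 + 2 * (norm z)\<^sup>2) = real m * a / (1 + (norm z)\<^sup>2)" for a
  proof -
    have "2 + 2 * (norm z)\<^sup>2 = 2 * (1 + (norm z)\<^sup>2)" by simp
    then show ?thesis by (metis mult.left_commute mult_divide_mult_cancel_left zero_neq_numeral)
  qed
  show ?thesis
    by (simp add: frd wirtinger_def fs_form_def inner_axis inner_complex_def complex_eq_iff
        Re_divide_of_real Im_divide_of_real field_simps del: of_real_add of_real_power,
        simp only: half simp_thms)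
qed

lemma chern_nabla_eq: "chern_nabla m s i z = nabla m (\<lambda>w. s (affine_vec i w)) z"
  by (simp add: chern_nabla_def nabla_def wirtinger_fs_potential vec_eq_iff)

definition fs_form_deriv ::
    "nat \<Rightarrow> (complex, 'n::finite) vec \<Rightarrow> 'n \<Rightarrow> (complex, 'n) vec \<Rightarrow> complex" where
  "fs_form_deriv m z k w = of_nat m * (cnj (w $ k) / of_real (1 + (norm z)\<^sup>2)
    - cnj (z $ k) * of_real (2 * (z \<bullet> w)) / (of_real (1 + (norm z)\<^sup>2))\<^sup>2)"

text \<open>The real derivative of \<open>nabla m f\<close> at \<open>z\<close> in direction \<open>w\<close>; it is not complex linear in \<open>w\<close>.\<close>

definition nabla_deriv ::
    "nat \<Rightarrow> ((complex, 'n::finite) vec \<Rightarrow> complex) \<Rightarrow>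
      (complex, 'n) vec \<Rightarrow> (complex, 'n) vec \<Rightarrow> (complex, 'n) vec" where
  "nabla_deriv m f z w = (\<chi> k. (\<Sum>j\<in>UNIV. w $ j * wirtinger (\<lambda>z. wirtinger f z k) z j)
    - (f z * fs_form_deriv m z k w + (\<Sum>j\<in>UNIV. w $ j * wirtinger f z j) * fs_form m z k))"

lemma has_derivative_fs_form:
  "((\<lambda>z. fs_form m z k) has_derivative fs_form_deriv m z k) (at z)"
proof -
  have ne: "complex_of_real (1 + (norm z)\<^sup>2) \<noteq> 0"
    using one_plus_norm_pos(2)[of z] of_real_eq_0_iff by blast
  have num: "((\<lambda>z. of_nat m * cnj (z $ k)) has_derivative (\<lambda>w. of_nat m * cnj (w $ k))) (at z)"
    by (intro has_derivative_mult_right bounded_linear.has_derivative[OF bounded_linear_cnj]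
        has_derivative_vec_nth has_derivative_ident)
  have den: "((\<lambda>z. complex_of_real (1 + (norm z)\<^sup>2)) has_derivative
      (\<lambda>w. of_real (2 * (z \<bullet> w)))) (at z)"
    by (intro bounded_linear.has_derivative[OF bounded_linear_of_real] has_derivative_norm_sq)
  have "(\<lambda>w. (of_nat m * cnj (w $ k) * of_real (1 + (norm z)\<^sup>2)
      - of_nat m * cnj (z $ k) * of_real (2 * (z \<bullet> w)))
      / (of_real (1 + (norm z)\<^sup>2) * of_real (1 + (norm z)\<^sup>2))) = fs_form_deriv m z k"
    using ne by (simp add: fs_form_deriv_def fun_eq_iff field_simps power2_eq_square del: of_real_add of_real_mult)
  with has_derivative_divide'[OF num den ne] show ?thesis
    unfolding fs_form_def by metis
qed

lemma has_derivative_vec_lambda: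
  fixes f :: "'a::real_normed_vector \<Rightarrow> 'n::finite \<Rightarrow> complex"
  assumes "\<And>k. ((\<lambda>z. f z k) has_derivative f' k) (at z)"
  shows "((\<lambda>z. \<chi> k. f z k) has_derivative (\<lambda>v. \<chi> k. f' k v)) (at z)"
proof (subst has_derivative_componentwise_within, rule ballI)
  fix b :: "(complex, 'n) vec"
  assume "b \<in> Basis"
  then obtain k u where b: "b = axis k u"
    by (auto simp: Basis_vec_def)
  show "((\<lambda>z. (\<chi> k. f z k) \<bullet> b) has_derivative (\<lambda>v. (\<chi> k. f' k v) \<bullet> b)) (at z)"
    using has_derivative_inner_left[OF assms[of k], of u] by (simp add: b inner_axis)
qed

lemma has_derivative_nabla:
  assumes "cpoly f"
  shows "(nabla m f has_derivative nabla_deriv m f z) (at z)"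
  unfolding nabla_def nabla_deriv_def
  by (intro has_derivative_vec_lambda derivative_intros has_derivative_fs_form
      cpoly_has_derivative cpoly_wirtinger assms)

section \<open>Degenerate critical points are rare\<close>

text \<open>
  The two ways in which \<open>|s|\<^sup>2\<close> can fail to be Morse at \<open>z\<close> are treated as one condition on a zero of
  \<open>\<nabla>s\<close>: if \<open>f z = 0\<close>, it says that \<open>z\<close> is a singular point of the zero locus.
\<close>

definition degenerate_zero ::
    "nat \<Rightarrow> ((complex, 'n::finite) vec \<Rightarrow> complex) \<Rightarrow> (complex, 'n) vec \<Rightarrow> bool" where
  "degenerate_zero m f z \<longleftrightarrow>
    nabla m f z = 0 \<and> (f z = 0 \<or> (\<exists>w. w \<noteq> 0 \<and> nabla_deriv m f z w = 0))"

text \<open>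
  The effect, in the chart \<open>i\<close>, of adding \<open>Z\<^sub>i\<^sup>m\<^sup>-\<^sup>1 \<ell>(Z)\<close> to a section, for the linear form \<open>\<ell>\<close> with
  coefficients \<open>X\<close>.
\<close>

definition pencil ::
    "'n::finite option \<Rightarrow> ((complex, 'n) vec \<Rightarrow> complex) \<Rightarrow> (complex, 'n option) vec \<Rightarrow>
      (complex, 'n) vec \<Rightarrow> complex" where
  "pencil i f0 X z = f0 z + (\<Sum>j\<in>UNIV. X $ j * affine_vec i z $ j)"

lemma pencil_eq:
  "pencil i f0 X z = f0 z + X $ i + (\<Sum>k\<in>UNIV. X $ chart_coord i k * z $ k)"
  unfolding pencil_def by (subst sum_chart_index[of _ i]) (simp add: affine_vec_chart_vec)

lemma cpoly_pencil: "cpoly f0 \<Longrightarrow> cpoly (pencil i f0 X)"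
  unfolding pencil_def by (intro cpoly_add cpoly_sum cpoly_mult cpoly_const cpoly_affine_vec)

lemma wirtinger_pencil:
  assumes "cpoly f0"
  shows "wirtinger (pencil i f0 X) z k = wirtinger f0 z k + X $ chart_coord i k"
proof -
  have "pencil i f0 X = (\<lambda>z. f0 z + (X $ i + (\<Sum>k\<in>UNIV. X $ chart_coord i k * z $ k)))"
    by (simp add: fun_eq_iff pencil_eq)
  then show ?thesis
    by (simp add: wirtinger_add wirtinger_sum wirtinger_cmult wirtinger_const wirtinger_coord
        assms cpoly_const cpoly_coord cpoly_mult cpoly_sum cpoly_add if_distrib cong: if_cong)
qed

text \<open>
  The linear form \<open>X\<close> for which \<open>pencil i f0 X\<close> takes the value \<open>b\<close> and has a vanishing \<open>nabla\<close> at \<open>z\<close>, as a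
  function of \<open>p = (b, z)\<close>: the equations \<open>\<partial>\<^sub>k f = b \<partial>\<^sub>k\<phi>\<close> determine the coefficients with index
  \<open>chart_coord i k\<close>, and then \<open>f z = b\<close> determines the one with index \<open>i\<close>.  Taking the value \<open>b\<close> as a
  parameter, instead of solving for the constant coefficient, avoids a linear system
  that is singular where \<open>(m - 1) |z|\<^sup>2 = 1\<close>.
\<close>

definition critical_pencil ::
    "nat \<Rightarrow> 'n::finite option \<Rightarrow> ((complex, 'n) vec \<Rightarrow> complex) \<Rightarrow>
      complex \<times> (complex, 'n) vec \<Rightarrow> (complex, 'n option) vec" where
  "critical_pencil m i f0 p = chart_vec i
    (fst p - f0 (snd p)
      - (\<Sum>k\<in>UNIV. (fst p * fs_form m (snd p) k - wirtinger f0 (snd p) k) * snd p $ k))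
    (\<chi> k. fst p * fs_form m (snd p) k - wirtinger f0 (snd p) k)"

lemma critical_pencil_differentiable:
  assumes "cpoly f0"
  shows "critical_pencil m i f0 differentiable (at p)"
proof -
  have sn: "snd differentiable (at p)" for p :: "complex \<times> (complex, 'a) vec"
    by (intro bounded_linear_imp_differentiable bounded_linear_snd)
  have fs: "fst differentiable (at p)" for p :: "complex \<times> (complex, 'a) vec"
    by (intro bounded_linear_imp_differentiable bounded_linear_fst)
  have comp: "(\<lambda>p. h (snd p)) differentiable (at p)"
    if "\<And>z. h differentiable (at z)" for h :: "(complex, 'a) vec \<Rightarrow> complex" and p :: "complex \<times> (complex, 'a) vec"
    using differentiable_chain_at[OF sn that] by (simp add: o_def)
  have poly: "(\<lambda>p. g (snd p)) differentiable (at p)"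
    if "cpoly g" for g :: "(complex, 'a) vec \<Rightarrow> complex" and p :: "complex \<times> (complex, 'a) vec"
    by (intro comp cpoly_differentiable that)
  have form: "(\<lambda>p. fs_form m (snd p) k) differentiable (at p)"
    for k and p :: "complex \<times> (complex, 'a) vec"
    using has_derivative_fs_form by (intro comp) (auto simp: differentiable_def)
  have y: "(\<lambda>p. fst p * fs_form m (snd p) k - wirtinger f0 (snd p) k) differentiable (at p)" for k
    by (intro differentiable_diff differentiable_mult fs form poly cpoly_wirtinger assms)
  have "(\<lambda>p. fst p - f0 (snd p)
      - (\<Sum>k\<in>UNIV. (fst p * fs_form m (snd p) k - wirtinger f0 (snd p) k) * snd p $ k))
      differentiable (at p)"
    by (intro differentiable_diff differentiable_sum differentiable_mult ballI y fs poly assms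
        cpoly_coord finite)
  then obtain a' where a': "((\<lambda>p. fst p - f0 (snd p)
      - (\<Sum>k\<in>UNIV. (fst p * fs_form m (snd p) k - wirtinger f0 (snd p) k) * snd p $ k))
      has_derivative a') (at p)"
    by (auto simp: differentiable_def)
  define y' where "y' k = frechet_derivative
    (\<lambda>p. fst p * fs_form m (snd p) k - wirtinger f0 (snd p) k) (at p)" for k
  have "((\<lambda>p. fst p * fs_form m (snd p) k - wirtinger f0 (snd p) k)
      has_derivative y' k) (at p)" for k
    using y[of k] unfolding y'_def frechet_derivative_works .
  from has_derivative_vec_lambda[OF this]
  have "((\<lambda>p. \<chi> k. fst p * fs_form m (snd p) k - wirtinger f0 (snd p) k)
      has_derivative (\<lambda>v. \<chi> k. y' k v)) (at p)" .
  from bounded_linear.has_derivative[OF bounded_linear_chart_vec[of i] has_derivative_Pair[OF a' this]]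
  show ?thesis
    unfolding critical_pencil_def differentiable_def by auto
qed

text \<open>
  A linear form can be read off from the value and the \<open>nabla\<close> of its member of the pencil at any point
  \<open>z\<close>, critical or not.  That the left side does not depend on \<open>z\<close> is what makes this useful: the identity can
  be differentiated.
\<close>

lemma pencil_recovered:
  assumes "cpoly f0"
  shows "X = critical_pencil m i f0 (pencil i f0 X z, z)
    + chart_vec i (- (\<Sum>k\<in>UNIV. nabla m (pencil i f0 X) z $ k * z $ k))
        (nabla m (pencil i f0 X) z)"
    (is "X = ?G + ?T")
proof -
  have k: "(?G + ?T) $ chart_coord i k = X $ chart_coord i k" for k
    by (simp add: critical_pencil_def nabla_def wirtinger_pencil[OF assms])
  have "(?G + ?T) $ i = pencil i f0 X z - f0 z - (\<Sum>k\<in>UNIV. (?G + ?T) $ chart_coord i k * z $ k)"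
    by (simp add: critical_pencil_def algebra_simps sum.distrib sum_subtractf)
  also have "\<dots> = X $ i"
    unfolding k by (simp add: pencil_eq)
  finally have "(?G + ?T) $ i = X $ i" .
  with k have "X $ j = (?G + ?T) $ j" for j
    by (rule_tac chart_index_cases[of j i]) simp_all
  then show ?thesis
    by (simp add: vec_eq_iff)
qed

text \<open>
  Differentiate \<open>pencil_recovered\<close> at the critical point \<open>z\<close> in a direction \<open>w\<close> in the kernel of \<open>nabla_deriv\<close>.
  The left side is constant, and the second summand on the right contributes nothing because both
  \<open>nabla\<close> and its derivative along \<open>w\<close> vanish.  What remains says that the nonzero vector \<open>(f' w, w)\<close> is in the
  kernel of \<open>G'\<close>.
\<close>

lemma critical_pencil_singular:
  assumes f0: "cpoly f0" and crit: "nabla m (pencil i f0 X) z = 0"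
    and w: "nabla_deriv m (pencil i f0 X) z w = 0" "w \<noteq> 0"
    and G': "(critical_pencil m i f0 has_derivative G') (at (pencil i f0 X z, z))"
  shows "\<not> inj G'"
proof
  let ?f = "pencil i f0 X" and ?F = "nabla m (pencil i f0 X)"
  define f' where "f' = (\<lambda>v. \<Sum>k\<in>UNIV. v $ k * wirtinger ?f z k)"
  define F' where "F' = nabla_deriv m ?f z"
  have f': "(?f has_derivative f') (at z)"
    unfolding f'_def by (intro cpoly_has_derivative cpoly_pencil f0)
  have F': "(?F has_derivative F') (at z)"
    unfolding F'_def by (intro has_derivative_nabla cpoly_pencil f0)
  have g: "((\<lambda>y. critical_pencil m i f0 (?f y, y)) has_derivative (\<lambda>v. G' (f' v, v))) (at z)"
    using diff_chain_at[OF has_derivative_Pair[OF f' has_derivative_ident]] G' by (simp add: o_def)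
  have "((\<lambda>y. - (\<Sum>k\<in>UNIV. ?F y $ k * y $ k)) has_derivative
      (\<lambda>v. - (\<Sum>k\<in>UNIV. ?F z $ k * v $ k + F' v $ k * z $ k))) (at z)"
    by (intro derivative_intros F')
  from bounded_linear.has_derivative[OF bounded_linear_chart_vec[of i] has_derivative_Pair[OF this F']]
  have t: "((\<lambda>y. chart_vec i (- (\<Sum>k\<in>UNIV. ?F y $ k * y $ k)) (?F y)) has_derivative
      (\<lambda>v. chart_vec i (- (\<Sum>k\<in>UNIV. ?F z $ k * v $ k + F' v $ k * z $ k)) (F' v))) (at z)"
    by simp
  have "((\<lambda>_. X) has_derivative
      (\<lambda>v. G' (f' v, v) + chart_vec i (- (\<Sum>k\<in>UNIV. ?F z $ k * v $ k + F' v $ k * z $ k)) (F' v))) (at z)"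
    using has_derivative_add[OF g t] by (simp flip: pencil_recovered[OF f0])
  then have "(\<lambda>v. G' (f' v, v) + chart_vec i (- (\<Sum>k\<in>UNIV. ?F z $ k * v $ k + F' v $ k * z $ k)) (F' v))
      = (\<lambda>_. 0)"
    by (rule has_derivative_unique) (rule has_derivative_const)
  from fun_cong[OF this, of w]
  have "G' (f' w, w) + chart_vec i 0 0 = 0"
    using crit w by (simp add: F'_def)
  moreover have "chart_vec i 0 0 = 0"
    by (simp add: chart_vec_def vec_eq_iff split: option.split)
  ultimately have "G' (f' w, w) = G' 0"
    using has_derivative_linear[OF G'] by (simp add: linear_0)
  moreover assume "inj G'"
  ultimately have "(f' w, w) = 0" by (metis injD)
  with w(2) show False by (simp add: zero_prod_def)
qed

lemma negligible_degenerate_pencil: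
  fixes f0 :: "(complex, 'n::finite) vec \<Rightarrow> complex"
  assumes f0: "cpoly f0"
  shows "negligible {X. \<exists>z. degenerate_zero m (pencil i f0 X) z}"
proof -
  let ?G = "critical_pencil m i f0"
  define G' where "G' p = frechet_derivative ?G (at p)" for p
  have G': "(?G has_derivative G' p) (at p)" for p
    using critical_pencil_differentiable[OF f0] by (simp add: G'_def frechet_derivative_works)
  have dim: "DIM(complex \<times> (complex, 'n) vec) = DIM((complex, 'n option) vec)"
    by simp
  have "negligible (?G ` {p. \<not> inj (G' p)})"
    by (rule Sard_equidimensional[OF dim G']) simp
  moreover have "negligible (?G ` {p. (1, 0) \<bullet> p = 0})"
    using critical_pencil_differentiable[OF f0] dim
    by (intro negligible_differentiable_image_negligible negligible_hyperplane)
       (auto simp: differentiable_on_def differentiable_at_withinI zero_prod_def)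
  ultimately have "negligible (?G ` {p. \<not> inj (G' p)} \<union> ?G ` {p. (1, 0) \<bullet> p = 0})"
    by (rule negligible_Un)
  then show ?thesis
  proof (rule negligible_subset, intro subsetI)
    fix X assume "X \<in> {X. \<exists>z. degenerate_zero m (pencil i f0 X) z}"
    then obtain z where z: "nabla m (pencil i f0 X) z = 0"
        "pencil i f0 X z = 0 \<or> (\<exists>w. w \<noteq> 0 \<and> nabla_deriv m (pencil i f0 X) z w = 0)"
      by (auto simp: degenerate_zero_def)
    have "chart_vec i 0 0 = 0"
      by (simp add: chart_vec_def vec_eq_iff split: option.split)
    with z(1) have X: "X = ?G (pencil i f0 X z, z)"
      using pencil_recovered[OF f0, of X m i z] by simp
    from z(2) show "X \<in> ?G ` {p. \<not> inj (G' p)} \<union> ?G ` {p. (1, 0) \<bullet> p = 0}"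
    proof
      assume "pencil i f0 X z = 0"
      with X show ?thesis by (intro UnI2 image_eqI[of _ _ "(pencil i f0 X z, z)"]) simp_all
    next
      assume "\<exists>w. w \<noteq> 0 \<and> nabla_deriv m (pencil i f0 X) z w = 0"
      then have "\<not> inj (G' (pencil i f0 X z, z))"
        using critical_pencil_singular[OF f0 z(1) _ _ G'] by blast
      then show ?thesis using X by (intro UnI1 image_eqI[of _ _ "(pencil i f0 X z, z)"]) simp_all
    qed
  qed
qed

section \<open>The exceptional coefficients form a null set\<close>

lemma finite_multi_indices: "finite (multi_indices m :: ('n::finite option \<Rightarrow> nat) set)"
proof (rule finite_subset)
  show "multi_indices m \<subseteq> PiE UNIV (\<lambda>_::'n option. {..m})"
  proof
    fix \<alpha> :: "'n option \<Rightarrow> nat" assume "\<alpha> \<in> multi_indices m"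
    then have "\<alpha> i \<le> m" for i
      using member_le_sum[of i UNIV \<alpha>] by (simp add: multi_indices_def)
    then show "\<alpha> \<in> PiE UNIV (\<lambda>_. {..m})" by auto
  qed
qed (simp add: finite_PiE)

definition mono_fun ::
    "'n::finite option \<Rightarrow> ('n option \<Rightarrow> nat) \<Rightarrow> (complex, 'n) vec \<Rightarrow> complex" where
  "mono_fun i \<alpha> z = (\<Prod>j\<in>UNIV. affine_vec i z $ j ^ \<alpha> j)"

lemma cpoly_mono_fun: "cpoly (mono_fun i \<alpha>)"
  unfolding mono_fun_def by (intro cpoly_prod cpoly_power cpoly_affine_vec)

definition chart_poly ::
    "nat \<Rightarrow> 'n::finite option \<Rightarrow> (('n option \<Rightarrow> nat) \<Rightarrow> complex) \<Rightarrow> (complex, 'n) vec \<Rightarrow> complex" where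
  "chart_poly m i c z = hom_poly m c (affine_vec i z)"

lemma chart_poly_eq: "chart_poly m i c = (\<lambda>z. \<Sum>\<alpha>\<in>multi_indices m. c \<alpha> * mono_fun i \<alpha> z)"
  by (simp add: chart_poly_def hom_poly_def mono_fun_def fun_eq_iff)

lemma cpoly_chart_poly: "cpoly (chart_poly m i c)"
  unfolding chart_poly_eq by (intro cpoly_sum cpoly_mult cpoly_const cpoly_mono_fun)

lemma wirtinger_chart_poly:
  "wirtinger (chart_poly m i c) z k = (\<Sum>\<alpha>\<in>multi_indices m. c \<alpha> * wirtinger (mono_fun i \<alpha>) z k)"
  unfolding chart_poly_eq
  by (simp add: wirtinger_sum wirtinger_cmult cpoly_mult cpoly_const cpoly_mono_fun)

lemma wirtinger2_chart_poly:
  "wirtinger (\<lambda>z. wirtinger (chart_poly m i c) z k) z j =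
    (\<Sum>\<alpha>\<in>multi_indices m. c \<alpha> * wirtinger (\<lambda>z. wirtinger (mono_fun i \<alpha>) z k) z j)"
  unfolding wirtinger_chart_poly
  by (simp add: wirtinger_sum wirtinger_cmult cpoly_mult cpoly_const cpoly_mono_fun cpoly_wirtinger)

text \<open>The exponents of the monomial \<open>Z\<^sub>i\<^sup>m\<^sup>-\<^sup>1 Z\<^sub>j\<close>.\<close>

definition pencil_index :: "nat \<Rightarrow> 'n option \<Rightarrow> 'n option \<Rightarrow> 'n option \<Rightarrow> nat" where
  "pencil_index m i j l = (if l = i then m - 1 else 0) + (if l = j then 1 else 0)"

lemma inj_pencil_index: "inj (pencil_index m i)"
proof (rule injI)
  fix j j' assume "pencil_index m i j = pencil_index m i j'"
  from fun_cong[OF this, of j] show "j = j'"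
    by (simp add: pencil_index_def split: if_splits)
qed

lemma pencil_index_multi:
  "m \<ge> 1 \<Longrightarrow> range (pencil_index m i) \<subseteq> (multi_indices m :: ('n::finite option \<Rightarrow> nat) set)"
  by (auto simp: multi_indices_def pencil_index_def sum.distrib)

lemma mono_fun_pencil_index: "mono_fun i (pencil_index m i j) z = affine_vec i z $ j"
proof -
  have "mono_fun i (pencil_index m i j) z = (\<Prod>l\<in>UNIV. if l = j then affine_vec i z $ l else 1)"
    unfolding mono_fun_def by (rule prod.cong) (auto simp: pencil_index_def)
  then show ?thesis by simp
qed

lemma chart_poly_pencil:
  fixes i :: "'n::finite option"
  assumes "m \<ge> 1"
  shows "chart_poly m i (\<lambda>\<alpha>. if \<alpha> \<in> range (pencil_index m i)
      then X $ inv (pencil_index m i) \<alpha> else y \<alpha>) =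
    pencil i (\<lambda>z. \<Sum>\<alpha>\<in>multi_indices m - range (pencil_index m i). y \<alpha> * mono_fun i \<alpha> z) X"
  (is "chart_poly m i ?c = _")
proof
  fix z
  let ?R = "range (pencil_index m i)"
  have "chart_poly m i ?c z = (\<Sum>\<alpha>\<in>multi_indices m - ?R. ?c \<alpha> * mono_fun i \<alpha> z)
      + (\<Sum>\<alpha>\<in>?R. ?c \<alpha> * mono_fun i \<alpha> z)"
    unfolding chart_poly_eq
    by (rule sum.subset_diff[OF pencil_index_multi[OF assms] finite_multi_indices])
  also have "(\<Sum>\<alpha>\<in>?R. ?c \<alpha> * mono_fun i \<alpha> z) = (\<Sum>j\<in>UNIV. X $ j * affine_vec i z $ j)"
    by (simp add: sum.reindex inj_pencil_index mono_fun_pencil_index)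
  finally show "chart_poly m i ?c z =
    pencil i (\<lambda>z. \<Sum>\<alpha>\<in>multi_indices m - ?R. y \<alpha> * mono_fun i \<alpha> z) X z"
    by (simp add: pencil_def)
qed

text \<open>Normalising the kernel vector makes the parameters of degeneracy range over compact sets.\<close>

lemma degenerate_zero_iff:
  assumes "cpoly f"
  shows "(\<exists>z. degenerate_zero m f z) \<longleftrightarrow>
    (\<exists>n::nat. \<exists>x\<in>cball 0 (real n) \<times> sphere 0 1.
      norm (nabla m f (fst x)) + norm (f (fst x)) * norm (nabla_deriv m f (fst x) (snd x)) = 0)"
    (is "?L \<longleftrightarrow> ?R")
proof
  assume ?L
  then obtain z where z: "degenerate_zero m f z" by blast
  obtain n where n: "norm z \<le> real n" using real_arch_simple by blast
  have "\<exists>w\<in>sphere 0 1. norm (f z) * norm (nabla_deriv m f z w) = 0"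
  proof (cases "f z = 0")
    case True
    (* If f z = 0, the second factor is arbitrary and any unit vector will do. *)
    have "axis undefined 1 \<in> sphere (0 :: (complex, 'a) vec) 1" 
      by (simp add: norm_eq_sqrt_inner inner_axis_axis)
    with True show ?thesis by (metis mult_zero_left norm_zero)
  next
    case False
    with z obtain w where w: "w \<noteq> 0" "nabla_deriv m f z w = 0"
      by (auto simp: degenerate_zero_def)
    have "linear (nabla_deriv m f z)"
      using has_derivative_nabla[OF assms] by (rule has_derivative_linear)
    then have "nabla_deriv m f z (w /\<^sub>R norm w) = 0"
      using w by (simp add: linear_cmul)
    moreover have "w /\<^sub>R norm w \<in> sphere 0 1" using w by simp
    ultimately show ?thesis by (metis mult_zero_right norm_zero)
  qed
  then obtain w where "w \<in> sphere 0 1" "norm (f z) * norm (nabla_deriv m f z w) = 0" by blast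
  with z n show ?R
    by (intro exI[of _ n] bexI[of _ "(z, w)"]) (auto simp: degenerate_zero_def)
next
  assume ?R
  then obtain z w where *: "norm w = 1"
      "norm (nabla m f z) + norm (f z) * norm (nabla_deriv m f z w) = 0"
    by auto
  then have "nabla m f z = 0" "f z = 0 \<or> nabla_deriv m f z w = 0"
    by (simp_all add: add_nonneg_eq_0_iff)
  moreover have "w \<noteq> 0" using * by auto
  ultimately show ?L unfolding degenerate_zero_def by blast
qed

lemma continuous_on_nabla_deriv:
  assumes "cpoly f"
  shows "continuous_on S (\<lambda>x. nabla_deriv m f (fst x) (snd x))"
proof -
  have poly: "continuous_on S (\<lambda>x. g (fst x))" if "cpoly g" for g
    by (rule continuous_on_compose2[OF cpoly_continuous[OF that, of UNIV] continuous_on_fst[OF continuous_on_id]]) auto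
  have ne: "complex_of_real (1 + (norm z)\<^sup>2) \<noteq> 0" for z :: "(complex, 'a) vec"
    using one_plus_norm_pos(2)[of z] of_real_eq_0_iff by blast
  have [continuous_intros]: "continuous_on S (\<lambda>x. h x $ k)" if "continuous_on S h"
    for h :: "(complex, 'a) vec \<times> (complex, 'a) vec \<Rightarrow> (complex, 'a) vec" and k
    by (rule bounded_linear.continuous_on[OF bounded_linear_vec_nth that])
  show ?thesis
    unfolding nabla_deriv_def fs_form_def fs_form_deriv_def
    by (intro continuous_on_vec_lambda continuous_intros poly cpoly_wirtinger assms ballI)
       (use ne in auto)
qed

text \<open>
  The polynomial, its \<open>nabla\<close> and its \<open>nabla_deriv\<close> at given arguments are linear in the coefficients \<open>c\<close>, hence
  measurable in \<open>c\<close>; for given \<open>c\<close> they are continuous in the arguments.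
\<close>

lemma sets_degenerate:
  "{c \<in> space (PiM (multi_indices m) (\<lambda>_. lborel :: complex measure)).
      \<exists>z. degenerate_zero m (chart_poly m i c) z}
    \<in> sets (PiM (multi_indices m) (\<lambda>_. lborel))"
proof -
  let ?M = "PiM (multi_indices m) (\<lambda>_. lborel :: complex measure)"
  have coef [measurable]: "(\<lambda>c. c \<alpha>) \<in> borel_measurable ?M" if "\<alpha> \<in> multi_indices m" for \<alpha>
    using measurable_component_singleton[OF that, of "\<lambda>_. lborel :: complex measure"] by simp
  have lin [measurable]: "(\<lambda>c. \<Sum>\<alpha>\<in>multi_indices m. c \<alpha> * b \<alpha>) \<in> borel_measurable ?M" for b
    by (intro borel_measurable_sum borel_measurable_times coef) auto
  have val: "(\<lambda>c. chart_poly m i c z) \<in> borel_measurable ?M" for z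
    unfolding chart_poly_eq by (rule lin)
  have nab: "(\<lambda>c. nabla m (chart_poly m i c) z) \<in> borel_measurable ?M" for z
    unfolding nabla_def wirtinger_chart_poly
    by (intro borel_measurable_vec_lambda borel_measurable_diff borel_measurable_times
        lin val borel_measurable_const)
  have der: "(\<lambda>c. nabla_deriv m (chart_poly m i c) z w) \<in> borel_measurable ?M" for z w
    unfolding nabla_deriv_def wirtinger2_chart_poly
    unfolding wirtinger_chart_poly
    by (intro borel_measurable_vec_lambda borel_measurable_diff borel_measurable_times
        borel_measurable_add borel_measurable_sum lin val borel_measurable_const)
  have meas: "(\<lambda>c. norm (nabla m (chart_poly m i c) z)
      + norm (chart_poly m i c z) * norm (nabla_deriv m (chart_poly m i c) z w)) \<in> borel_measurable ?M" for z w
    using val[of z] nab[of z] der[of z w] by measurable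
  have "{c \<in> space ?M. \<exists>z. degenerate_zero m (chart_poly m i c) z} =
    (\<Union>n::nat. {c \<in> space ?M. \<exists>x\<in>cball 0 (real n) \<times> sphere 0 1.
      norm (nabla m (chart_poly m i c) (fst x))
      + norm (chart_poly m i c (fst x)) * norm (nabla_deriv m (chart_poly m i c) (fst x) (snd x)) = 0})"
    unfolding degenerate_zero_iff[OF cpoly_chart_poly] by blast
  also have "\<dots> \<in> sets ?M"
  proof (intro sets.countable_UN subsetI, elim imageE, simp only:, rule sets_Collect_compact_zero)
    fix n :: nat and c
    have "continuous_on UNIV (nabla m (chart_poly m i c))"
      by (intro continuous_at_imp_continuous_on ballI
          has_derivative_continuous[OF has_derivative_nabla[OF cpoly_chart_poly]])
    then have "continuous_on S (\<lambda>x. nabla m (chart_poly m i c) (fst x))" for S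
      by (rule continuous_on_compose2[OF _ continuous_on_fst[OF continuous_on_id]]) auto
    moreover have "continuous_on S (\<lambda>x. chart_poly m i c (fst x))" for S
      by (rule continuous_on_compose2[OF cpoly_continuous[OF cpoly_chart_poly, of UNIV]
          continuous_on_fst[OF continuous_on_id]]) auto
    ultimately show "continuous_on (cball 0 (real n) \<times> sphere 0 1) (\<lambda>x.
        norm (nabla m (chart_poly m i c) (fst x))
        + norm (chart_poly m i c (fst x)) * norm (nabla_deriv m (chart_poly m i c) (fst x) (snd x)))"
      by (intro continuous_intros continuous_on_nabla_deriv cpoly_chart_poly)
  qed (auto intro: compact_Times meas)
  finally show ?thesis .
qed

lemma null_sets_degenerate:
  fixes i :: "'n::finite option"
  assumes "m \<ge> 1"
  shows "{c \<in> space (PiM (multi_indices m) (\<lambda>_. lborel :: complex measure)).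
      \<exists>z. degenerate_zero m (chart_poly m i c) z}
    \<in> null_sets (PiM (multi_indices m) (\<lambda>_. lborel))"
proof (rule null_PiM_if_null_slices[OF inj_pencil_index finite_multi_indices
      pencil_index_multi[OF assms] sets_degenerate])
  fix y :: "('n option \<Rightarrow> nat) \<Rightarrow> complex"
  let ?R = "range (pencil_index m i)"
  have "cpoly (\<lambda>z. \<Sum>\<alpha>\<in>multi_indices m - ?R. y \<alpha> * mono_fun i \<alpha> z)"
    by (intro cpoly_sum cpoly_mult cpoly_const cpoly_mono_fun)
  from negligible_degenerate_pencil[OF this]
  show "negligible {X. (\<lambda>\<alpha>. if \<alpha> \<in> ?R then X $ inv (pencil_index m i) \<alpha> else y \<alpha>)
      \<in> {c \<in> space (PiM (multi_indices m) (\<lambda>_. lborel :: complex measure)).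
          \<exists>z. degenerate_zero m (chart_poly m i c) z}}"
    by (rule negligible_subset) (auto simp: chart_poly_pencil[OF assms])
qed

definition degenerate_section ::
    "nat \<Rightarrow> ((complex, 'n::finite option) vec \<Rightarrow> complex) \<Rightarrow> bool" where
  "degenerate_section m s \<longleftrightarrow> (\<exists>i z. degenerate_zero m (\<lambda>z. s (affine_vec i z)) z)"

lemma H0_null_set_degenerate:
  assumes "m \<ge> 1"
  shows "H0_null_set m {s \<in> H0 m. degenerate_section m s}"
proof -
  let ?M = "PiM (multi_indices m) (\<lambda>_. lborel :: complex measure)"
  have "{c \<in> PiE (multi_indices m) (\<lambda>_. UNIV).
      hom_poly m c \<in> {s \<in> H0 m. degenerate_section m s}} =
    (\<Union>i. {c \<in> space ?M. \<exists>z. degenerate_zero m (chart_poly m i c) z})"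
    by (auto simp: H0_def space_PiM degenerate_section_def chart_poly_def[abs_def])
  also have "\<dots> \<in> null_sets ?M"
    by (intro null_sets.finite_UN null_sets_degenerate assms) auto
  finally show ?thesis
    unfolding H0_null_set_def by (auto intro: null_sets_completionI)
qed

section \<open>Affine charts of projective space\<close>

lemma abs_cpn_eq_iff: "Z \<noteq> 0 \<Longrightarrow> W \<noteq> 0 \<Longrightarrow> abs_cpn Z = abs_cpn W \<longleftrightarrow> proportional Z W"
  using Quotient3_rel[OF Quotient3_cpn, of Z W] by (simp add: proportional_refl)

definition dehomogenize ::
    "'n::finite option \<Rightarrow> (complex, 'n option) vec \<Rightarrow> (complex, 'n) vec" where
  "dehomogenize i Z = (\<chi> k. Z $ chart_coord i k / Z $ i)"

lemma abs_cpn_eq_affine_pt_iff: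
  assumes "Z \<noteq> 0"
  shows "abs_cpn Z = affine_pt i z \<longleftrightarrow> Z $ i \<noteq> 0 \<and> z = dehomogenize i Z"
proof
  assume "abs_cpn Z = affine_pt i z"
  then have "proportional (affine_vec i z) Z"
    using assms by (metis abs_cpn_eq_iff affine_pt_def affine_vec_nonzero)
  then obtain c where c: "Z = c *s affine_vec i z" by (auto simp: proportional_def)
  then have "c \<noteq> 0" using assms by auto
  with c show "Z $ i \<noteq> 0 \<and> z = dehomogenize i Z"
    by (simp add: dehomogenize_def vec_eq_iff affine_vec_chart_vec)
next
  assume *: "Z $ i \<noteq> 0 \<and> z = dehomogenize i Z"
  then have "inverse (Z $ i) *s Z = chart_vec i 1 z"
    by (intro chart_vec_eqI) (simp_all add: dehomogenize_def field_simps)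
  then have "proportional Z (affine_vec i z)"
    using assms by (auto simp: proportional_def affine_vec_chart_vec[symmetric] intro: exI[of _ "inverse (Z $ i)"] dest: sym)
  then show "abs_cpn Z = affine_pt i z"
    using assms by (simp add: affine_pt_def abs_cpn_eq_iff)
qed

lemma dehomogenize_affine_vec: "dehomogenize i (affine_vec i z) = z"
  by (simp add: dehomogenize_def vec_eq_iff affine_vec_chart_vec)

lemma inj_affine_pt: "affine_pt i z = affine_pt i w \<Longrightarrow> z = w"
  using abs_cpn_eq_affine_pt_iff[OF affine_vec_nonzero, of i z i w]
  by (simp add: affine_pt_def dehomogenize_affine_vec)

lemma affine_charts_cover: obtains i z where "affine_pt i z = p"
proof -
  have "proportional (rep_cpn p) (rep_cpn p)"
    by (rule Quotient3_rep_reflp[OF Quotient3_cpn])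
  then have nz: "rep_cpn p \<noteq> 0" by (simp add: proportional_def)
  then obtain i where "rep_cpn p $ i \<noteq> 0" by (auto simp: vec_eq_iff)
  with nz have "abs_cpn (rep_cpn p) = affine_pt i (dehomogenize i (rep_cpn p))"
    by (simp add: abs_cpn_eq_affine_pt_iff)
  then show ?thesis
    using that Quotient3_abs_rep[OF Quotient3_cpn, of p] by metis
qed

lemma continuous_on_affine_vec: "continuous_on S (affine_vec i)"
proof -
  have "continuous_on S (\<lambda>z. \<chi> j. affine_vec i z $ j)"
    by (intro continuous_on_vec_lambda cpoly_continuous cpoly_affine_vec)
  then show ?thesis by simp
qed

lemma continuous_on_affine_pt: "continuous_on S (affine_pt i)"
proof (rule continuous_on_subset[OF _ subset_UNIV])
  have "open (affine_pt i -` U)" if "open U" for U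
  proof -
    have "affine_pt i -` U = affine_vec i -` {Z. Z \<noteq> 0 \<and> abs_cpn Z \<in> U}"
      by (auto simp: affine_pt_def)
    moreover have "open (affine_vec i -` {Z. Z \<noteq> 0 \<and> abs_cpn Z \<in> U})"
      using that by (intro open_vimage continuous_on_affine_vec) (simp add: open_cpn_def)
    ultimately show ?thesis by simp
  qed
  then show "continuous_on UNIV (affine_pt i)"
    by (simp add: continuous_on_open_vimage[OF open_UNIV])
qed

lemma open_affine_pt_image:
  assumes "open V"
  shows "open (affine_pt i ` V)"
proof -
  let ?U = "{Z :: (complex, 'a option) vec. Z $ i \<noteq> 0}"
  have "open ?U"
    by (intro open_Collect_neq continuous_intros)
  moreover have "continuous_on ?U (dehomogenize i)"
    unfolding dehomogenize_def by (intro continuous_on_vec_lambda continuous_intros) auto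
  ultimately have "open (?U \<inter> dehomogenize i -` V)"
    using assms by (intro continuous_open_preimage)
  moreover have "Z \<noteq> 0 \<and> abs_cpn Z \<in> affine_pt i ` V \<longleftrightarrow> Z $ i \<noteq> 0 \<and> dehomogenize i Z \<in> V" for Z
    by (cases "Z = 0") (auto simp: image_iff abs_cpn_eq_affine_pt_iff)
  then have "{Z. Z \<noteq> 0 \<and> abs_cpn Z \<in> affine_pt i ` V} = ?U \<inter> dehomogenize i -` V"
    by auto
  ultimately show ?thesis by (simp add: open_cpn_def)
qed

section \<open>First and second derivatives of the Fubini--Study norm\<close>

definition chart_norm2 :: "nat \<Rightarrow> ((complex, 'n::finite) vec \<Rightarrow> complex) \<Rightarrow> (complex, 'n) vec \<Rightarrow> real" where
  "chart_norm2 m f x = (cmod (f x))\<^sup>2 / (1 + (norm x)\<^sup>2) ^ m"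

definition chart_norm2_deriv ::
    "nat \<Rightarrow> ((complex, 'n::finite) vec \<Rightarrow> complex) \<Rightarrow> (complex, 'n) vec \<Rightarrow> (complex, 'n) vec \<Rightarrow> real" where
  "chart_norm2_deriv m f x v =
    2 * Re (cnj (f x) * (\<Sum>k\<in>UNIV. v $ k * nabla m f x $ k)) / (1 + (norm x)\<^sup>2) ^ m"

lemma inner_complex_Re: "a \<bullet> b = Re (cnj a * b)"
  by (simp add: inner_complex_def)

lemma has_derivative_norm_power:
  "((\<lambda>x::'a::real_inner. (1 + (norm x)\<^sup>2) ^ m) has_derivative
    (\<lambda>v. (1 + (norm x)\<^sup>2) ^ m * (real m * (2 * (x \<bullet> v)) / (1 + (norm x)\<^sup>2)))) (at x)"
proof -
  have "((\<lambda>x. (1 + (norm x)\<^sup>2) ^ m) has_derivative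
      (\<lambda>v. of_nat m * (2 * (x \<bullet> v)) * (1 + (norm x)\<^sup>2) ^ (m - 1))) (at x)"
    by (intro has_derivative_power has_derivative_norm_sq)
  moreover have "of_nat m * (2 * (x \<bullet> v)) * (1 + (norm x)\<^sup>2) ^ (m - 1)
      = (1 + (norm x)\<^sup>2) ^ m * (real m * (2 * (x \<bullet> v)) / (1 + (norm x)\<^sup>2))" for v
    using one_plus_norm_pos(2)[of x] by (cases m) (simp_all add: field_simps)
  ultimately show ?thesis by simp
qed

lemma sum_fs_form:
  "Re (\<Sum>k\<in>UNIV. v $ k * fs_form m x k) = real m * (x \<bullet> v) / (1 + (norm x)\<^sup>2)"
proof -
  have "Re (v $ k * fs_form m x k) = real m * (x $ k \<bullet> v $ k) / (1 + (norm x)\<^sup>2)" for k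
    by (simp add: fs_form_def inner_complex_def Re_divide_of_real algebra_simps
        del: of_real_add of_real_power)
  then show ?thesis
    by (simp add: inner_vec_def sum_divide_distrib sum_distrib_left)
qed

text \<open>
  The derivative of \<open>(1 + |x|\<^sup>2)\<^sup>-\<^sup>m\<close> is the term \<open>- f \<partial>\<phi>\<close> of the connection, which combines with \<open>\<partial>f\<close> to \<open>nabla\<close>.
\<close>

lemma has_derivative_chart_norm2:
  assumes "cpoly f"
  shows "(chart_norm2 m f has_derivative chart_norm2_deriv m f x) (at x)"
proof -
  let ?D = "1 + (norm x)\<^sup>2"
  have ne: "?D ^ m \<noteq> 0" using one_plus_norm_pos(2)[of x] by simp
  have f: "((\<lambda>x. (cmod (f x))\<^sup>2) has_derivative
      (\<lambda>v. 2 * (f x \<bullet> (\<Sum>k\<in>UNIV. v $ k * wirtinger f x k)))) (at x)"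
    unfolding power2_norm_eq_inner
    using has_derivative_inner[OF cpoly_has_derivative cpoly_has_derivative, OF assms assms]
    by (simp add: inner_commute)
  have "((2 * (f x \<bullet> (\<Sum>k\<in>UNIV. v $ k * wirtinger f x k))) * ?D ^ m
        - (cmod (f x))\<^sup>2 * (?D ^ m * (real m * (2 * (x \<bullet> v)) / ?D))) / (?D ^ m * ?D ^ m)
      = chart_norm2_deriv m f x v" for v
  proof -
    have "(\<Sum>k\<in>UNIV. v $ k * nabla m f x $ k) = (\<Sum>k\<in>UNIV. v $ k * wirtinger f x k)
        - f x * (\<Sum>k\<in>UNIV. v $ k * fs_form m x k)"
      by (simp add: nabla_def algebra_simps sum_subtractf sum_distrib_left)
    then have "Re (cnj (f x) * (\<Sum>k\<in>UNIV. v $ k * nabla m f x $ k))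
      = f x \<bullet> (\<Sum>k\<in>UNIV. v $ k * wirtinger f x k)
        - Re ((cnj (f x) * f x) * (\<Sum>k\<in>UNIV. v $ k * fs_form m x k))"
      by (simp add: inner_complex_Re right_diff_distrib mult.assoc del: Re_sum Im_sum times_complex.sel)
    also have "cnj (f x) * f x = of_real ((cmod (f x))\<^sup>2)"
      using complex_norm_square[of "f x"] by (simp add: mult.commute)
    finally have eq: "Re (cnj (f x) * (\<Sum>k\<in>UNIV. v $ k * nabla m f x $ k))
      = f x \<bullet> (\<Sum>k\<in>UNIV. v $ k * wirtinger f x k)
        - (cmod (f x))\<^sup>2 * (real m * (x \<bullet> v) / ?D)"
      by (simp add: sum_fs_form[symmetric] del: Re_sum of_real_power)
    have alg: "(2 * a * P - b * (P * (r * (2 * q) / d))) / (P * P) = 2 * (a - b * (r * q / d)) / P"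
      if "P \<noteq> 0" "d \<noteq> 0" for a b d P q r :: real
      using that by (simp add: field_simps)
    show ?thesis
      unfolding chart_norm2_deriv_def eq by (rule alg[OF ne one_plus_norm_pos(2)])
  qed
  then have "(\<lambda>v. ((2 * (f x \<bullet> (\<Sum>k\<in>UNIV. v $ k * wirtinger f x k))) * ?D ^ m
        - (cmod (f x))\<^sup>2 * (?D ^ m * (real m * (2 * (x \<bullet> v)) / ?D))) / (?D ^ m * ?D ^ m))
      = chart_norm2_deriv m f x" by (rule ext)
  with has_derivative_divide'[OF f has_derivative_norm_power ne] show ?thesis
    unfolding chart_norm2_def by simp
qed

lemma pairing_nondegenerate:
  fixes y :: "(complex, 'n::finite) vec"
  assumes "\<And>v :: (complex, 'n) vec. Re (a * (\<Sum>k\<in>UNIV. v $ k * y $ k)) = 0" "a \<noteq> 0"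
  shows "y = 0"
proof -
  have "Re (a * (cnj (a * u) * u)) = (cmod (a * u))\<^sup>2" for u
    using complex_norm_square[of "a * u"]
    by (metis Re_complex_of_real mult.assoc mult.commute)
  then have "(\<Sum>k\<in>UNIV. (cmod (a * y $ k))\<^sup>2) = Re (a * (\<Sum>k\<in>UNIV. (\<chi> k. cnj (a * y $ k)) $ k * y $ k))"
    by (simp add: sum_distrib_left del: complex_cnj_mult)
  also have "\<dots> = 0" by (rule assms)
  finally show ?thesis
    using assms(2) by (simp add: sum_nonneg_eq_0_iff vec_eq_iff)
qed

lemma chart_norm2_critical_iff:
  assumes "cpoly f"
  shows "(chart_norm2 m f has_derivative (\<lambda>_. 0)) (at z) \<longleftrightarrow> f z = 0 \<or> nabla m f z = 0"
proof -
  have "(chart_norm2 m f has_derivative (\<lambda>_. 0)) (at z) \<longleftrightarrow> chart_norm2_deriv m f z = (\<lambda>_. 0)"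
    using has_derivative_chart_norm2[OF assms] has_derivative_unique by metis
  also have "\<dots> \<longleftrightarrow> f z = 0 \<or> nabla m f z = 0"
  proof
    assume *: "chart_norm2_deriv m f z = (\<lambda>_. 0)"
    have aux: "r = 0" if "2 * r / d = 0" "d \<noteq> 0" for r d :: real
      using that by simp
    from * have "2 * Re (cnj (f z) * (\<Sum>k\<in>UNIV. v $ k * nabla m f z $ k)) / (1 + (norm z)\<^sup>2) ^ m = 0" for v
      unfolding chart_norm2_deriv_def by metis
    then have "Re (cnj (f z) * (\<Sum>k\<in>UNIV. v $ k * nabla m f z $ k)) = 0" for v
      using aux one_plus_norm_pos(2)[of z] power_not_zero by blast
    from pairing_nondegenerate[OF this] show "f z = 0 \<or> nabla m f z = 0" by auto
  qed (auto simp: chart_norm2_deriv_def)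
  finally show ?thesis .
qed

definition chart_hessian_form ::
    "nat \<Rightarrow> ((complex, 'n::finite) vec \<Rightarrow> complex) \<Rightarrow> (complex, 'n) vec \<Rightarrow>
      (complex, 'n) vec \<Rightarrow> (complex, 'n) vec \<Rightarrow> real" where
  "chart_hessian_form m f z v w = 2 * Re (
      cnj (\<Sum>k\<in>UNIV. w $ k * wirtinger f z k) * (\<Sum>k\<in>UNIV. v $ k * nabla m f z $ k)
      + cnj (f z) * (\<Sum>k\<in>UNIV. v $ k * nabla_deriv m f z w $ k)) / (1 + (norm z)\<^sup>2) ^ m"

text \<open>
  At a critical point the numerator of \<open>chart_norm2_deriv\<close> vanishes, so the derivative of the
  denominator drops out.
\<close>

lemma has_derivative_chart_norm2_deriv:
  assumes f: "cpoly f" and crit: "f z = 0 \<or> nabla m f z = 0"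
  shows "((\<lambda>x. chart_norm2_deriv m f x v) has_derivative chart_hessian_form m f z v) (at z)"
proof -
  let ?D = "1 + (norm z)\<^sup>2"
  have ne: "?D ^ m \<noteq> 0" using one_plus_norm_pos(2)[of z] by simp
  have "((\<lambda>x. \<Sum>k\<in>UNIV. v $ k * nabla m f x $ k) has_derivative
      (\<lambda>w. \<Sum>k\<in>UNIV. v $ k * nabla_deriv m f z w $ k)) (at z)"
    by (intro has_derivative_sum has_derivative_mult_right has_derivative_vec_nth
        has_derivative_nabla f)
  from has_derivative_mult[OF bounded_linear.has_derivative[OF bounded_linear_cnj
      cpoly_has_derivative[OF f]] this]
  have "((\<lambda>x. 2 * Re (cnj (f x) * (\<Sum>k\<in>UNIV. v $ k * nabla m f x $ k))) has_derivative
    (\<lambda>w. 2 * Re (cnj (f z) * (\<Sum>k\<in>UNIV. v $ k * nabla_deriv m f z w $ k) +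
      cnj (\<Sum>k\<in>UNIV. w $ k * wirtinger f z k) * (\<Sum>k\<in>UNIV. v $ k * nabla m f z $ k)))) (at z)"
    by (intro has_derivative_mult_right bounded_linear.has_derivative[OF bounded_linear_Re])
  from has_derivative_divide'[OF this has_derivative_norm_power ne]
  have "((\<lambda>x. chart_norm2_deriv m f x v) has_derivative
    (\<lambda>w. 2 * Re (cnj (f z) * (\<Sum>k\<in>UNIV. v $ k * nabla_deriv m f z w $ k) +
      cnj (\<Sum>k\<in>UNIV. w $ k * wirtinger f z k) * (\<Sum>k\<in>UNIV. v $ k * nabla m f z $ k))
      * ?D ^ m / (?D ^ m * ?D ^ m))) (at z)"
    using crit unfolding chart_norm2_deriv_def by (elim disjE) (simp_all del: Re_sum Im_sum times_complex.sel)
  moreover have "(\<lambda>w. 2 * Re (cnj (f z) * (\<Sum>k\<in>UNIV. v $ k * nabla_deriv m f z w $ k) +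
      cnj (\<Sum>k\<in>UNIV. w $ k * wirtinger f z k) * (\<Sum>k\<in>UNIV. v $ k * nabla m f z $ k))
      * ?D ^ m / (?D ^ m * ?D ^ m)) = chart_hessian_form m f z v"
    using ne unfolding chart_hessian_form_def fun_eq_iff by (simp add: add.commute del: Re_sum Im_sum times_complex.sel)
  ultimately show ?thesis by simp
qed

lemma hessian_chart_norm2:
  assumes "cpoly f" "f z = 0 \<or> nabla m f z = 0"
  shows "hessian (chart_norm2 m f) z v w = chart_hessian_form m f z v w"
proof -
  have "(\<lambda>x. frechet_derivative (chart_norm2 m f) (at x) v) = (\<lambda>x. chart_norm2_deriv m f x v)"
    using frechet_derivative_at[OF has_derivative_chart_norm2[OF assms(1)]] by metis
  then show ?thesis
    unfolding hessian_def
    using frechet_derivative_at[OF has_derivative_chart_norm2_deriv[OF assms]] by metis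
qed

text \<open>
  The Hessian of \<open>log g\<close> is that of \<open>g\<close> divided by \<open>g\<close>, up to a term quadratic in \<open>dg\<close>, which
  vanishes at a critical point.
\<close>

lemma hessian_ln_chart_norm2:
  assumes f: "cpoly f" and crit: "nabla m f z = 0" and nz: "f z \<noteq> 0"
  shows "hessian (\<lambda>x. ln (chart_norm2 m f x)) z v w = chart_hessian_form m f z v w / chart_norm2 m f z"
proof -
  let ?g = "chart_norm2 m f"
  have pos: "?g x > 0" if "f x \<noteq> 0" for x
    using that one_plus_norm_pos(1)[of x] by (simp add: chart_norm2_def)
  have ln: "frechet_derivative (\<lambda>x. ln (?g x)) (at x) v = chart_norm2_deriv m f x v / ?g x"
    if "f x \<noteq> 0" for x
    using frechet_derivative_at[OF has_derivative_ln[OF pos[OF that] has_derivative_chart_norm2[OF f]]]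
    by (metis divide_inverse)
  have "((\<lambda>x. chart_norm2_deriv m f x v / ?g x) has_derivative
      (\<lambda>w. (chart_hessian_form m f z v w * ?g z - chart_norm2_deriv m f z v * chart_norm2_deriv m f z w)
        / (?g z * ?g z))) (at z)"
    using crit pos[OF nz]
    by (intro has_derivative_divide' has_derivative_chart_norm2_deriv has_derivative_chart_norm2 f) auto
  then have "((\<lambda>x. frechet_derivative (\<lambda>x. ln (?g x)) (at x) v) has_derivative
      (\<lambda>w. (chart_hessian_form m f z v w * ?g z - chart_norm2_deriv m f z v * chart_norm2_deriv m f z w)
        / (?g z * ?g z))) (at z)"
  proof (rule has_derivative_transform_within_open)
    show "open {x. f x \<noteq> 0}"
      by (intro open_Collect_neq cpoly_continuous f continuous_on_const)
  qed (use nz ln in auto)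
  moreover have "chart_norm2_deriv m f z u = 0" for u
    using crit by (simp add: chart_norm2_deriv_def)
  ultimately have "((\<lambda>x. frechet_derivative (\<lambda>x. ln (?g x)) (at x) v) has_derivative
      (\<lambda>w. chart_hessian_form m f z v w / ?g z)) (at z)"
    using pos[OF nz] by simp
  from frechet_derivative_at[OF this] show ?thesis
    unfolding hessian_def by metis
qed

text \<open>
  An injective \<open>nabla_deriv\<close> is surjective, so in the Hessian it takes all values, and \<open>v\<close> is orthogonal to
  everything under a perfect pairing.
\<close>

lemma chart_hessian_nondegenerate:
  assumes f: "cpoly f" and crit: "nabla m f z = 0" and nz: "f z \<noteq> 0"
    and inj: "\<And>w. nabla_deriv m f z w = 0 \<Longrightarrow> w = 0"
    and ker: "\<And>w. chart_hessian_form m f z v w = 0"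
  shows "v = 0"
proof (rule pairing_nondegenerate)
  fix y :: "(complex, 'a) vec"
  have lin: "linear (nabla_deriv m f z)"
    using has_derivative_nabla[OF f] by (rule has_derivative_linear)
  then have "inj (nabla_deriv m f z)"
    using inj by (auto simp: linear_injective_0)
  with lin have "surj (nabla_deriv m f z)"
    by (rule linear_inj_imp_surj)
  then obtain w where "nabla_deriv m f z w = y" by (metis surjD)
  with ker[of w] crit have "Re (cnj (f z) * (\<Sum>k\<in>UNIV. v $ k * y $ k)) = 0"
    using one_plus_norm_pos(2)[of z] by (simp add: chart_hessian_form_def del: Re_sum times_complex.sel)
  then show "Re (cnj (f z) * (\<Sum>k\<in>UNIV. y $ k * v $ k)) = 0"
    by (simp add: mult.commute)
qed (use nz in simp)

lemma chart_hessian_zero_locus: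
  assumes "f z = 0" and ker: "chart_hessian_form m f z v v = 0"
  shows "(\<Sum>k\<in>UNIV. v $ k * wirtinger f z k) = 0"
proof -
  let ?d = "\<Sum>k\<in>UNIV. v $ k * wirtinger f z k"
  have "(\<Sum>k\<in>UNIV. v $ k * nabla m f z $ k) = ?d"
    using assms by (simp add: nabla_def)
  with ker have "Re (cnj ?d * ?d) = 0"
    using one_plus_norm_pos(2)[of z] by (simp add: chart_hessian_form_def assms(1) del: Re_sum times_complex.sel)
  moreover have "Re (cnj ?d * ?d) = (cmod ?d)\<^sup>2"
    by (metis Re_complex_of_real complex_norm_square mult.commute)
  ultimately show ?thesis by simp
qed

lemma injective_derivative_isolated_zero:
  fixes F :: "'a::euclidean_space \<Rightarrow> 'b::euclidean_space"
  assumes F: "(F has_derivative F') (at z)" and zero: "F z = 0"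
    and inj: "\<And>w. F' w = 0 \<Longrightarrow> w = 0"
  obtains e where "e > 0" "\<And>x. x \<in> ball z e \<Longrightarrow> F x = 0 \<Longrightarrow> x = z"
proof -
  have lin: "linear F'" using F by (rule has_derivative_linear)
  then have "inj F'" using inj by (auto simp: linear_injective_0)
  with lin obtain B where B: "B > 0" "\<And>x. B * norm x \<le> norm (F' x)"
    using linear_inj_bounded_below_pos by blast
  obtain d where d: "d > 0" "\<And>y. norm (y - z) < d \<Longrightarrow>
      norm (F y - F z - F' (y - z)) \<le> B / 2 * norm (y - z)"
    using F B(1) unfolding has_derivative_at_alt by (meson half_gt_zero)
  show ?thesis
  proof (rule that[OF d(1)])
    fix x assume x: "x \<in> ball z d" "F x = 0"
    then have "norm (F' (x - z)) \<le> B / 2 * norm (x - z)"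
      using d(2)[of x] zero by (simp add: dist_norm norm_minus_commute)
    with B(2)[of "x - z"] have "B * norm (x - z) \<le> B / 2 * norm (x - z)" by linarith
    with B(1) show "x = z" by simp
  qed
qed

section \<open>Calculus of smooth functions\<close>

lemma Ck_on_cong:
  assumes "open S" "\<And>x. x \<in> S \<Longrightarrow> f x = g x" "Ck_on k S f"
  shows "Ck_on k S g"
  using assms(2,3)
proof (induction k arbitrary: f g)
  case 0
  then show ?case using continuous_on_cong[of S S f g] by simp
next
  case (Suc k)
  have g: "(g has_derivative frechet_derivative f (at x)) (at x)" if "x \<in> S" for x
  proof (rule has_derivative_transform_within_open[OF _ \<open>open S\<close> that])
    show "(f has_derivative frechet_derivative f (at x)) (at x)"
      using Suc.prems(2) that by (simp flip: frechet_derivative_works)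
  qed (use Suc.prems(1) in auto)
  have eq: "frechet_derivative f (at x) = frechet_derivative g (at x)" if "x \<in> S" for x
    using g[OF that] by (rule frechet_derivative_at)
  have "Ck_on k S (\<lambda>x. frechet_derivative g (at x) b)" if "b \<in> Basis" for b
  proof (rule Suc.IH)
    show "Ck_on k S (\<lambda>x. frechet_derivative f (at x) b)"
      using Suc.prems(2) that by simp
  qed (simp add: eq)
  with g show ?case by (auto simp: differentiable_def)
qed

lemma Ck_on_SucI:
  assumes "open S" "\<And>x. x \<in> S \<Longrightarrow> (f has_derivative f' x) (at x)"
    and "\<And>b. b \<in> Basis \<Longrightarrow> Ck_on k S (\<lambda>x. f' x b)"
  shows "Ck_on (Suc k) S f"
proof -
  have "Ck_on k S (\<lambda>x. frechet_derivative f (at x) b)" if "b \<in> Basis" for b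
    using frechet_derivative_at[OF assms(2)] by (intro Ck_on_cong[OF assms(1) _ assms(3)[OF that]]) metis
  with assms(2) show ?thesis by (auto simp: differentiable_def)
qed

lemma Ck_on_Suc_derivative:
  assumes "Ck_on (Suc k) S f"
  obtains f' where "\<And>x. x \<in> S \<Longrightarrow> (f has_derivative f' x) (at x)"
    "\<And>b. b \<in> Basis \<Longrightarrow> Ck_on k S (\<lambda>x. f' x b)"
  using assms by (intro that[of "\<lambda>x. frechet_derivative f (at x)"]) (auto simp flip: frechet_derivative_works)

lemma Ck_on_SucD: "Ck_on (Suc k) S f \<Longrightarrow> Ck_on k S f"
proof (induction k arbitrary: f)
  case 0
  then show ?case
    by (auto intro!: continuous_at_imp_continuous_on differentiable_imp_continuous_within)
next
  case (Suc k)
  from Suc.prems show ?case by (auto intro: Suc.IH)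
qed

lemma Ck_on_const: "open S \<Longrightarrow> Ck_on k S (\<lambda>_. c)"
proof (induction k arbitrary: c)
  case (Suc k)
  then show ?case by (intro Ck_on_SucI[where f' = "\<lambda>_ _. 0"]) auto
qed simp

lemma Ck_on_bounded_linear:
  assumes "open S" "bounded_linear L" "Ck_on k S f"
  shows "Ck_on k S (\<lambda>x. L (f x))"
  using assms(3)
proof (induction k arbitrary: f)
  case 0
  then show ?case by (simp add: bounded_linear.continuous_on[OF assms(2)])
next
  case (Suc k)
  obtain f' where "\<And>x. x \<in> S \<Longrightarrow> (f has_derivative f' x) (at x)"
    "\<And>b. b \<in> Basis \<Longrightarrow> Ck_on k S (\<lambda>x. f' x b)"
    using Ck_on_Suc_derivative[OF Suc.prems] by blast
  then show ?case
    by (intro Ck_on_SucI[OF assms(1), where f' = "\<lambda>x b. L (f' x b)"] Suc.IH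
        bounded_linear.has_derivative[OF assms(2)])
qed

lemma Ck_on_id: "open S \<Longrightarrow> Ck_on k S (\<lambda>x. x)"
  by (cases k) (auto intro!: Ck_on_SucI[where f' = "\<lambda>_ b. b"] Ck_on_const continuous_on_id simp del: Ck_on.simps(2))

lemma Ck_on_add:
  assumes "open S" "Ck_on k S f" "Ck_on k S g"
  shows "Ck_on k S (\<lambda>x. f x + g x)"
  using assms(2,3)
proof (induction k arbitrary: f g)
  case 0
  then show ?case by (simp add: continuous_on_add)
next
  case (Suc k)
  obtain f' where f': "\<And>x. x \<in> S \<Longrightarrow> (f has_derivative f' x) (at x)"
    "\<And>b. b \<in> Basis \<Longrightarrow> Ck_on k S (\<lambda>x. f' x b)"
    using Ck_on_Suc_derivative[OF Suc.prems(1)] by blast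
  obtain g' where g': "\<And>x. x \<in> S \<Longrightarrow> (g has_derivative g' x) (at x)"
    "\<And>b. b \<in> Basis \<Longrightarrow> Ck_on k S (\<lambda>x. g' x b)"
    using Ck_on_Suc_derivative[OF Suc.prems(2)] by blast
  show ?case
    by (intro Ck_on_SucI[OF assms(1), where f' = "\<lambda>x b. f' x b + g' x b"] Suc.IH
        has_derivative_add f' g')
qed

lemma Ck_on_mult:
  fixes f g :: "'a::euclidean_space \<Rightarrow> 'b::real_normed_algebra"
  assumes "open S" "Ck_on k S f" "Ck_on k S g"
  shows "Ck_on k S (\<lambda>x. f x * g x)"
  using assms(2,3)
proof (induction k arbitrary: f g)
  case 0
  then show ?case by (simp add: continuous_on_mult)
next
  case (Suc k)
  obtain f' where f': "\<And>x. x \<in> S \<Longrightarrow> (f has_derivative f' x) (at x)"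
    "\<And>b. b \<in> Basis \<Longrightarrow> Ck_on k S (\<lambda>x. f' x b)"
    using Ck_on_Suc_derivative[OF Suc.prems(1)] by blast
  obtain g' where g': "\<And>x. x \<in> S \<Longrightarrow> (g has_derivative g' x) (at x)"
    "\<And>b. b \<in> Basis \<Longrightarrow> Ck_on k S (\<lambda>x. g' x b)"
    using Ck_on_Suc_derivative[OF Suc.prems(2)] by blast
  show ?case
  proof (rule Ck_on_SucI[OF assms(1)])
    show "((\<lambda>x. f x * g x) has_derivative (\<lambda>b. f x * g' x b + f' x b * g x)) (at x)"
      if "x \<in> S" for x
      by (rule has_derivative_mult[OF f'(1)[OF that] g'(1)[OF that]])
    fix b :: 'a
    assume b: "b \<in> Basis"
    show "Ck_on k S (\<lambda>x. f x * g' x b + f' x b * g x)"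
      by (rule Ck_on_add[OF assms(1) Suc.IH[OF Ck_on_SucD[OF Suc.prems(1)] g'(2)[OF b]]
          Suc.IH[OF f'(2)[OF b] Ck_on_SucD[OF Suc.prems(2)]]])
  qed
qed

lemma Ck_on_inverse:
  fixes f :: "'a::euclidean_space \<Rightarrow> 'b::real_normed_field"
  assumes "open S" "\<And>x. x \<in> S \<Longrightarrow> f x \<noteq> 0" "Ck_on k S f"
  shows "Ck_on k S (\<lambda>x. inverse (f x))"
  using assms(3)
proof (induction k)
  case 0
  then show ?case using assms(2) by (auto intro: continuous_on_inverse)
next
  case (Suc k)
  obtain f' where f': "\<And>x. x \<in> S \<Longrightarrow> (f has_derivative f' x) (at x)"
    "\<And>b. b \<in> Basis \<Longrightarrow> Ck_on k S (\<lambda>x. f' x b)"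
    using Ck_on_Suc_derivative[OF Suc.prems] by blast
  have IH: "Ck_on k S (\<lambda>x. inverse (f x))"
    by (rule Suc.IH[OF Ck_on_SucD[OF Suc.prems]])
  show ?case
  proof (rule Ck_on_SucI[OF assms(1)])
    show "((\<lambda>x. inverse (f x)) has_derivative (\<lambda>b. - (inverse (f x) * f' x b * inverse (f x)))) (at x)"
      if "x \<in> S" for x
      by (rule Deriv.has_derivative_inverse[OF assms(2)[OF that] f'(1)[OF that]])
    fix b :: 'a
    assume b: "b \<in> Basis"
    show "Ck_on k S (\<lambda>x. - (inverse (f x) * f' x b * inverse (f x)))"
      by (rule Ck_on_bounded_linear[OF assms(1) bounded_linear_minus[OF bounded_linear_ident]
          Ck_on_mult[OF assms(1) Ck_on_mult[OF assms(1) IH f'(2)[OF b]] IH]])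
  qed
qed

lemma Ck_on_cpoly:
  assumes "open S" "Ck_on k S g" "cpoly p"
  shows "Ck_on k S (\<lambda>y. p (g y))"
  using assms(3)
  by induction (auto intro!: Ck_on_const Ck_on_add Ck_on_mult
      Ck_on_bounded_linear[OF _ bounded_linear_vec_nth] assms)

lemma Ck_on_power:
  fixes f :: "'a::euclidean_space \<Rightarrow> 'b::real_normed_algebra_1"
  shows "open S \<Longrightarrow> Ck_on k S f \<Longrightarrow> Ck_on k S (\<lambda>x. f x ^ d)"
  by (induction d) (auto intro: Ck_on_const Ck_on_mult)

lemma Ck_on_cmod_sq:
  assumes "open S" "Ck_on k S f"
  shows "Ck_on k S (\<lambda>x. (cmod (f x))\<^sup>2)"
proof -
  have "(\<lambda>x. (cmod (f x))\<^sup>2) = (\<lambda>x. Re (f x * cnj (f x)))"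
    by (metis Re_complex_of_real complex_norm_square)
  then show ?thesis
    by (simp only:) (intro Ck_on_bounded_linear[OF assms(1) bounded_linear_Re]
      Ck_on_bounded_linear[OF assms(1) bounded_linear_cnj] Ck_on_mult assms)
qed

lemma Ck_on_sum:
  assumes "open S" "\<And>a. a \<in> A \<Longrightarrow> Ck_on k S (f a)"
  shows "Ck_on k S (\<lambda>x. \<Sum>a\<in>A. f a x)"
  using assms(2)
  by (induction A rule: infinite_finite_induct) (auto intro: Ck_on_const Ck_on_add assms(1))

section \<open>Slice charts of a smooth zero locus\<close>

text \<open>
  The coordinate \<open>z\<^sub>k\<close> is replaced by \<open>f z\<close>, which straightens the zero locus of \<open>f\<close> to the subspace
  \<open>{y. y $ k = 0}\<close>.  The inverse of its derivative is explicit, and polynomial in the point up to one division.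
\<close>

definition slice_map ::
    "((complex, 'n::finite) vec \<Rightarrow> complex) \<Rightarrow> 'n \<Rightarrow> (complex, 'n) vec \<Rightarrow> (complex, 'n) vec" where
  "slice_map f k z = z + axis k (f z - z $ k)"

definition slice_deriv ::
    "((complex, 'n::finite) vec \<Rightarrow> complex) \<Rightarrow> 'n \<Rightarrow> (complex, 'n) vec \<Rightarrow>
      (complex, 'n) vec \<Rightarrow> (complex, 'n) vec" where
  "slice_deriv f k z b = b + axis k ((\<Sum>j\<in>UNIV. b $ j * wirtinger f z j) - b $ k)"

definition slice_inv_deriv ::
    "((complex, 'n::finite) vec \<Rightarrow> complex) \<Rightarrow> 'n \<Rightarrow> (complex, 'n) vec \<Rightarrow>
      (complex, 'n) vec \<Rightarrow> (complex, 'n) vec" where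
  "slice_inv_deriv f k z b =
    b + axis k ((b $ k - (\<Sum>j\<in>UNIV. b $ j * wirtinger f z j)) * inverse (wirtinger f z k))"

lemma axis_nth_same [simp]: "axis k c $ k = c"
  by (simp add: axis_def)

lemma slice_map_nth: "slice_map f k z $ k = f z"
  by (simp add: slice_map_def)

lemma bounded_linear_axis: "bounded_linear (axis k :: complex \<Rightarrow> (complex, 'n::finite) vec)"
proof -
  have "linear (axis k :: complex \<Rightarrow> (complex, 'n) vec)"
    by (rule linearI) (simp_all add: axis_def vec_eq_iff)
  then show ?thesis by (simp add: linear_conv_bounded_linear)
qed

lemma axis_add: "axis k a + axis k b = axis k (a + b)" for a b :: complex
  by (simp add: axis_def vec_eq_iff)

lemma slice_deriv_inverse:
  assumes "wirtinger f z k \<noteq> 0"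
  shows "slice_inv_deriv f k z (slice_deriv f k z b) = b"
    and "slice_deriv f k z (slice_inv_deriv f k z b) = b"
proof -
  let ?D = "\<lambda>b. \<Sum>j\<in>UNIV. b $ j * wirtinger f z j"
  have D: "?D (b + axis k c) = ?D b + c * wirtinger f z k" for c
    by (simp add: distrib_right sum.distrib sum_axis)
  have axis0: "axis k (0::complex) = 0"
    by (simp add: axis_def vec_eq_iff)
  define c where "c = ?D b - b $ k"
  have "slice_inv_deriv f k z (b + axis k c)
      = b + axis k (c + (b $ k + c - (?D b + c * wirtinger f z k)) * inverse (wirtinger f z k))"
    unfolding slice_inv_deriv_def D
    by (simp only: vector_add_component axis_nth_same add.assoc axis_add)
  also have "c + (b $ k + c - (?D b + c * wirtinger f z k)) * inverse (wirtinger f z k) = 0"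
    using assms by (simp add: c_def field_simps)
  finally show "slice_inv_deriv f k z (slice_deriv f k z b) = b"
    by (simp add: slice_deriv_def c_def axis0)
  define c where "c = (b $ k - ?D b) * inverse (wirtinger f z k)"
  have "slice_deriv f k z (b + axis k c)
      = b + axis k (c + ((?D b + c * wirtinger f z k) - (b $ k + c)))"
    unfolding slice_deriv_def D
    by (simp only: vector_add_component axis_nth_same add.assoc axis_add)
  also have "c + ((?D b + c * wirtinger f z k) - (b $ k + c)) = 0"
    using assms by (simp add: c_def field_simps)
  finally show "slice_deriv f k z (slice_inv_deriv f k z b) = b"
    by (simp add: slice_inv_deriv_def c_def axis0)
qed

lemma has_derivative_slice_map:
  assumes "cpoly f"
  shows "(slice_map f k has_derivative slice_deriv f k z) (at z)"
  unfolding slice_map_def slice_deriv_def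
  by (intro derivative_intros bounded_linear.has_derivative[OF bounded_linear_axis]
      cpoly_has_derivative assms)

lemma bounded_linear_slice_deriv:
  "cpoly f \<Longrightarrow> bounded_linear (slice_deriv f k z)"
  using has_derivative_slice_map has_derivative_bounded_linear by blast

definition slice_chart ::
    "((complex, 'n::finite) vec \<Rightarrow> complex) \<Rightarrow> 'n \<Rightarrow> (complex, 'n) vec \<Rightarrow>
      (complex, 'n) vec set \<Rightarrow> real \<Rightarrow> ((complex, 'n) vec \<Rightarrow> (complex, 'n) vec) \<Rightarrow> bool" where
  "slice_chart f k z U r g \<longleftrightarrow> open U \<and> z \<in> U \<and> r > 0 \<and>
    slice_map f k ` U = ball (slice_map f k z) r \<and> (\<forall>x\<in>U. g (slice_map f k x) = x) \<and>
    smooth_on U (slice_map f k) \<and> smooth_on (ball (slice_map f k z) r) g \<and>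
    (\<forall>y\<in>ball (slice_map f k z) r. (g has_derivative slice_inv_deriv f k (g y)) (at y))"

text \<open>
  The inverse function theorem gives a differentiable local inverse \<open>g\<close>.  Its smoothness is a bootstrap: by
  \<open>slice_inv_deriv\<close> the derivative of \<open>g\<close> is a rational expression in \<open>g\<close>, so \<open>g\<close> being \<open>C\<^sup>d\<close> makes it
  \<open>C\<^sup>d\<^sup>+\<^sup>1\<close>.
\<close>

lemma slice_chart_exists:
  assumes f: "cpoly f" and nz: "wirtinger f z0 k \<noteq> 0"
  shows "\<exists>U r g. slice_chart f k z0 U r g"
proof -
  let ?\<Phi> = "slice_map f k"
  define W where "W = {z. wirtinger f z k \<noteq> 0}"
  have W: "open W" "z0 \<in> W"
    unfolding W_def using nz
    by (auto intro!: open_Collect_neq cpoly_continuous cpoly_wirtinger f continuous_on_const)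
  define \<Phi>' where "\<Phi>' z = Blinfun (slice_deriv f k z)" for z
  have \<Phi>': "blinfun_apply (\<Phi>' z) = slice_deriv f k z" for z
    unfolding \<Phi>'_def by (rule bounded_linear_Blinfun_apply[OF bounded_linear_slice_deriv[OF f]])
  have lin_inv: "bounded_linear (slice_inv_deriv f k z0)"
  proof -
    have "(slice_inv_deriv f k z0 has_derivative slice_inv_deriv f k z0) (at 0)"
      unfolding slice_inv_deriv_def
      by (intro derivative_intros bounded_linear.has_derivative[OF bounded_linear_axis])
    then show ?thesis by (rule has_derivative_bounded_linear)
  qed
  have cont: "continuous_on W \<Phi>'"
  proof (rule continuous_on_blinfun_componentwise)
    fix b :: "(complex, 'a) vec"
    show "continuous_on W (\<lambda>z. blinfun_apply (\<Phi>' z) b)"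
      unfolding \<Phi>' slice_deriv_def
      by (intro continuous_intros bounded_linear.continuous_on[OF bounded_linear_axis]
          cpoly_continuous cpoly_wirtinger f)
  qed
  have inv0: "Blinfun (slice_inv_deriv f k z0) o\<^sub>L \<Phi>' z0 = id_blinfun"
    by (rule blinfun_eqI)
       (simp add: \<Phi>' bounded_linear_Blinfun_apply[OF lin_inv] slice_deriv_inverse[OF nz])
  have der: "(?\<Phi> has_derivative blinfun_apply (\<Phi>' z)) (at z)" for z
    unfolding \<Phi>' by (rule has_derivative_slice_map[OF f])
  obtain U0 V g g' where U0: "open U0" "U0 \<subseteq> W" "z0 \<in> U0" "open V" "?\<Phi> z0 \<in> V"
      "homeomorphism U0 V ?\<Phi> g" and
      g': "\<And>y. y \<in> V \<Longrightarrow> (g has_derivative (g' y)) (at y)"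
      "\<And>y. y \<in> V \<Longrightarrow> g' y = inv (blinfun_apply (\<Phi>' (g y)))"
    by (rule inverse_function_theorem[OF W(1) der cont W(2) inv0]) blast+
  obtain r where r: "r > 0" "ball (?\<Phi> z0) r \<subseteq> V"
    using U0(4,5) open_contains_ball by blast
  let ?B = "ball (?\<Phi> z0) r"
  have gV: "g y \<in> U0" "?\<Phi> (g y) = y" if "y \<in> V" for y
    using U0(6) that by (auto simp: homeomorphism_def)
  have gU: "?\<Phi> x \<in> V" "g (?\<Phi> x) = x" if "x \<in> U0" for x
    using U0(6) that by (auto simp: homeomorphism_def)
  have der_g: "(g has_derivative slice_inv_deriv f k (g y)) (at y)" if "y \<in> ?B" for y
  proof -
    have y: "y \<in> V" using that r by blast
    have "wirtinger f (g y) k \<noteq> 0" using gV(1)[OF y] U0(2) by (auto simp: W_def)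
    then have "inv (slice_deriv f k (g y)) = slice_inv_deriv f k (g y)"
      by (intro inv_equality slice_deriv_inverse)
    then show ?thesis using g'[OF y] by (simp add: \<Phi>')
  qed
  have smooth_g: "Ck_on d ?B g" for d
  proof (induction d)
    case 0
    show ?case
      using der_g by (auto intro!: continuous_at_imp_continuous_on has_derivative_continuous)
  next
    case (Suc d)
    have poly: "Ck_on d ?B (\<lambda>y. p (g y))" if "cpoly p" for p
      by (rule Ck_on_cpoly[OF open_ball Suc.IH that])
    show ?case
    proof (rule Ck_on_SucI[OF open_ball der_g])
      fix b :: "(complex, 'a) vec"
      have "cpoly (\<lambda>z. b $ k - (\<Sum>j\<in>UNIV. b $ j * wirtinger f z j))"
      proof -
        have "cpoly (\<lambda>z. b $ k + (- 1) * (\<Sum>j\<in>UNIV. b $ j * wirtinger f z j))"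
          by (intro cpoly_add cpoly_mult cpoly_const cpoly_sum cpoly_wirtinger f)
        then show ?thesis by simp
      qed
      moreover have "wirtinger f (g y) k \<noteq> 0" if "y \<in> ?B" for y
      proof -
        have "y \<in> V" using that r(2) by blast
        from gV(1)[OF this] show ?thesis using U0(2) by (auto simp: W_def)
      qed
      ultimately show "Ck_on d ?B (\<lambda>y. slice_inv_deriv f k (g y) b)"
        unfolding slice_inv_deriv_def
        by (intro Ck_on_add Ck_on_const Ck_on_bounded_linear[OF open_ball bounded_linear_axis]
            Ck_on_mult Ck_on_inverse poly cpoly_wirtinger f open_ball)
    qed
  qed
  have smooth_\<Phi>: "Ck_on d S ?\<Phi>" if "open S" for d S
  proof -
    have "cpoly (\<lambda>z. f z - z $ k)"
    proof -
      have "cpoly (\<lambda>z. f z + (- 1) * z $ k)"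
        by (intro cpoly_add cpoly_mult cpoly_const cpoly_coord f)
      then show ?thesis by simp
    qed
    then show ?thesis
      unfolding slice_map_def
      by (intro Ck_on_add Ck_on_id Ck_on_bounded_linear[OF that bounded_linear_axis]
          Ck_on_cpoly[OF that Ck_on_id] that)
  qed
  define U where "U = U0 \<inter> ?\<Phi> -` ?B"
  have cont\<Phi>: "continuous_on UNIV ?\<Phi>"
    using smooth_\<Phi>[OF open_UNIV, of 0] by simp
  have "open U"
    unfolding U_def using U0(1) cont\<Phi> by (intro open_Int open_vimage open_ball) auto
  moreover have "?\<Phi> ` U = ?B"
  proof
    show "?B \<subseteq> ?\<Phi> ` U"
    proof
      fix y assume y: "y \<in> ?B"
      then have "g y \<in> U" "?\<Phi> (g y) = y"
        using gV[of y] r(2) by (auto simp: U_def)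
      then show "y \<in> ?\<Phi> ` U" by (metis imageI)
    qed
  qed (auto simp: U_def)
  ultimately have "slice_chart f k z0 U r g"
    using U0(3) r(1) gU(2) smooth_\<Phi> smooth_g der_g
    by (auto simp: slice_chart_def U_def smooth_on_def)
  then show ?thesis by blast
qed

section \<open>Critical points of a nondegenerate section\<close>

abbreviation chart_fun ::
    "((complex, 'n::finite option) vec \<Rightarrow> complex) \<Rightarrow> 'n option \<Rightarrow> (complex, 'n) vec \<Rightarrow> complex" where
  "chart_fun s i \<equiv> \<lambda>z. s (affine_vec i z)"

lemma H0_cpoly: "s \<in> H0 m \<Longrightarrow> cpoly (chart_fun s i)"
  by (auto simp: H0_def cpoly_hom_poly)

lemma H0_fs_norm2:
  assumes "s \<in> H0 m"
  shows "fs_norm2 m s (affine_pt i z) = chart_norm2 m (chart_fun s i) z"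
  using assms fs_norm2_affine_pt[of s m i z] hom_poly_scale
  by (auto simp: H0_def chart_norm2_def)

lemma chart_norm2_eq_0_iff: "chart_norm2 m f z = 0 \<longleftrightarrow> f z = 0"
  using one_plus_norm_pos(2)[of z] by (simp add: chart_norm2_def)

lemma section_critical_point_iff:
  "section_critical_point m s p \<longleftrightarrow> (\<forall>i z. affine_pt i z = p \<longrightarrow> nabla m (chart_fun s i) z = 0)"
  by (simp add: section_critical_point_def chern_nabla_eq)

lemma nondegenerate_sectionD:
  assumes "\<not> degenerate_section m s" "nabla m (chart_fun s i) z = 0"
  shows "s (affine_vec i z) \<noteq> 0"
    and "nabla_deriv m (chart_fun s i) z w = 0 \<Longrightarrow> w = 0"
  using assms unfolding degenerate_section_def degenerate_zero_def by blast+

lemma section_critical_point_nondegenerate: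
  assumes s: "s \<in> H0 m" "\<not> degenerate_section m s" and p: "section_critical_point m s p"
  shows "nondegenerate_section_critical_point m s p"
  unfolding nondegenerate_section_critical_point_def
proof (intro conjI allI impI)
  obtain i z where "affine_pt i z = p" by (rule affine_charts_cover)
  with p have "nabla m (chart_fun s i) z = 0" by (simp add: section_critical_point_iff)
  from nondegenerate_sectionD(1)[OF s(2) this] \<open>affine_pt i z = p\<close>
  show "fs_norm2 m s p \<noteq> 0"
    using H0_fs_norm2[OF s(1), of i z] chart_norm2_eq_0_iff by metis
next
  fix i z v
  assume z: "affine_pt i z = p"
    and ker: "\<forall>w. hessian (\<lambda>x. ln (fs_norm2 m s (affine_pt i x))) z v w = 0"
  have crit: "nabla m (chart_fun s i) z = 0" using p z by (simp add: section_critical_point_iff)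
  note nz = nondegenerate_sectionD(1)[OF s(2) crit]
  show "v = 0"
  proof (rule chart_hessian_nondegenerate[OF H0_cpoly[OF s(1)] crit nz])
    show "chart_hessian_form m (chart_fun s i) z v w = 0" for w
      using ker hessian_ln_chart_norm2[OF H0_cpoly[OF s(1)] crit nz, of v w] nz
        chart_norm2_eq_0_iff[of m "chart_fun s i" z]
      by (simp add: H0_fs_norm2[OF s(1)])
  qed (rule nondegenerate_sectionD(2)[OF s(2) crit])
qed (rule p)

lemma section_critical_point_isolated:
  assumes s: "s \<in> H0 m" "\<not> degenerate_section m s" and p: "section_critical_point m s p"
  shows "p isolated_in {q. section_critical_point m s q}"
proof -
  obtain i z where z: "affine_pt i z = p" by (rule affine_charts_cover)
  with p have crit: "nabla m (chart_fun s i) z = 0" by (simp add: section_critical_point_iff)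
  obtain e where e: "e > 0"
      "\<And>x. x \<in> ball z e \<Longrightarrow> nabla m (chart_fun s i) x = 0 \<Longrightarrow> x = z"
    using injective_derivative_isolated_zero[OF has_derivative_nabla[OF H0_cpoly[OF s(1)]] crit
        nondegenerate_sectionD(2)[OF s(2) crit]] by metis
  have "affine_pt i ` ball z e \<inter> {q. section_critical_point m s q} = {p}"
  proof (intro subset_antisym subsetI)
    fix q assume q: "q \<in> affine_pt i ` ball z e \<inter> {q. section_critical_point m s q}"
    then obtain x where x: "x \<in> ball z e" "q = affine_pt i x" by blast
    with q have "nabla m (chart_fun s i) x = 0" by (simp add: section_critical_point_iff)
    with e(2)[OF x(1)] x(2) z show "q \<in> {p}" by simp
  qed (use z p e(1) in force)
  moreover have "open (affine_pt i ` ball z e)"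
    by (intro open_affine_pt_image open_ball)
  ultimately show ?thesis
    unfolding isolated_in_def using p by blast
qed

lemma critical_set_fs_norm2:
  assumes s: "s \<in> H0 m"
  shows "critical_set (fs_norm2 m s)
    = {p. section_critical_point m s p} \<union> {p. fs_norm2 m s p = 0}"
proof -
  have "((\<lambda>x. fs_norm2 m s (affine_pt i x)) has_derivative (\<lambda>_. 0)) (at z) \<longleftrightarrow>
      fs_norm2 m s p = 0 \<or> nabla m (chart_fun s i) z = 0" if "affine_pt i z = p" for i z p
  proof -
    have "(\<lambda>x. fs_norm2 m s (affine_pt i x)) = chart_norm2 m (chart_fun s i)"
      by (intro ext H0_fs_norm2[OF s])
    moreover have "fs_norm2 m s p = 0 \<longleftrightarrow> s (affine_vec i z) = 0"
      using H0_fs_norm2[OF s, of i z] that by (simp add: chart_norm2_eq_0_iff)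
    ultimately show ?thesis
      using chart_norm2_critical_iff[OF H0_cpoly[OF s], of m i z] by simp
  qed
  then have "p \<in> critical_set (fs_norm2 m s) \<longleftrightarrow> (\<forall>i z. affine_pt i z = p \<longrightarrow>
      fs_norm2 m s p = 0 \<or> nabla m (chart_fun s i) z = 0)" for p
    unfolding critical_set_def by simp
  then show ?thesis
    by (auto simp: section_critical_point_iff)
qed

lemma smooth_function_fs_norm2:
  assumes s: "s \<in> H0 m"
  shows "smooth_function (fs_norm2 m s)"
  unfolding smooth_function_def smooth_on_def
proof (intro allI)
  fix i d
  have norm_sq: "(norm x)\<^sup>2 = (\<Sum>k\<in>UNIV. (cmod (x $ k))\<^sup>2)" for x :: "(complex, 'a) vec"
    by (simp add: norm_vec_def L2_set_def sum_nonneg)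
  have "Ck_on d UNIV (\<lambda>z. (cmod (s (affine_vec i z)))\<^sup>2
      * inverse ((1 + (\<Sum>k\<in>UNIV. (cmod (z $ k))\<^sup>2)) ^ m))"
  proof (intro Ck_on_mult Ck_on_cmod_sq Ck_on_inverse Ck_on_power Ck_on_add Ck_on_const
      Ck_on_sum Ck_on_bounded_linear[OF _ bounded_linear_vec_nth] Ck_on_id open_UNIV)
    show "Ck_on d UNIV (chart_fun s i)"
      using Ck_on_cpoly[OF open_UNIV Ck_on_id[OF open_UNIV] H0_cpoly[OF s]] .
    show "(1 + (\<Sum>k\<in>UNIV. (cmod (z $ k))\<^sup>2)) ^ m \<noteq> 0" for z :: "(complex, 'a) vec"
      using one_plus_norm_pos(2)[of z] by (simp add: norm_sq)
  qed
  then show "Ck_on d UNIV (\<lambda>z. fs_norm2 m s (affine_pt i z))"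
    by (simp add: H0_fs_norm2[OF s] chart_norm2_def norm_sq divide_inverse)
qed

section \<open>Critical manifolds\<close>

lemma submanifold_point: "submanifold {p}"
  unfolding submanifold_def
proof (intro allI impI)
  fix i and z :: "(complex, 'a) vec"
  assume z: "affine_pt i z \<in> {p}"
  let ?\<Phi> = "\<lambda>x. x + - z"
  have smooth: "smooth_on UNIV (\<lambda>x. x + c)" for c :: "(complex, 'a) vec"
    unfolding smooth_on_def by (intro allI Ck_on_add Ck_on_id Ck_on_const open_UNIV)
  have inj: "inj ?\<Phi>" by (rule injI) simp
  have surj: "range ?\<Phi> = UNIV"
    by (rule surjI[of _ "\<lambda>x. x + z"]) simp
  have "inv_into UNIV ?\<Phi> = (\<lambda>x. x + z)"
    by (rule inv_equality) simp_all
  with smooth[of z] smooth[of "- z"] inj surj have "diffeo_onto_image UNIV ?\<Phi>"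
    by (simp add: diffeo_onto_image_def del: add_uminus_conv_diff)
  moreover have "affine_pt i -` {p} = {z}"
    using z inj_affine_pt by auto
  then have "?\<Phi> ` (UNIV \<inter> affine_pt i -` {p}) = ?\<Phi> ` UNIV \<inter> {0}"
    unfolding surj by simp
  ultimately show "\<exists>V \<Phi> L. z \<in> V \<and> diffeo_onto_image V \<Phi> \<and> subspace L \<and>
      \<Phi> ` (V \<inter> affine_pt i -` {p}) = \<Phi> ` V \<inter> L"
    by (intro exI[of _ UNIV] exI[of _ ?\<Phi>] exI[of _ "{0}"]) simp
qed

lemma nondegenerate_critical_manifold_point:
  assumes s: "s \<in> H0 m" "\<not> degenerate_section m s" and p: "section_critical_point m s p"
  shows "nondegenerate_critical_manifold (fs_norm2 m s) {p}"
  unfolding nondegenerate_critical_manifold_def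
proof (intro conjI allI impI)
  show "{p} \<subseteq> critical_set (fs_norm2 m s)"
    using p by (simp add: critical_set_fs_norm2[OF s(1)])
  fix i z v
  assume z: "affine_pt i z \<in> {p}"
    and ker: "\<forall>w. hessian (\<lambda>x. fs_norm2 m s (affine_pt i x)) z v w = 0"
  have crit: "nabla m (chart_fun s i) z = 0" using p z by (simp add: section_critical_point_iff)
  have "v = 0"
  proof (rule chart_hessian_nondegenerate[OF H0_cpoly[OF s(1)] crit
        nondegenerate_sectionD[OF s(2) crit]])
    show "chart_hessian_form m (chart_fun s i) z v w = 0" for w
      using ker hessian_chart_norm2[OF H0_cpoly[OF s(1)], of i z m v w] crit
      by (simp add: H0_fs_norm2[OF s(1)])
  qed
  with z show "v \<in> tangent_space {p} i z"
    unfolding tangent_space_def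
    by (auto intro!: exI[of _ "\<lambda>_. z"] always_eventually has_vector_derivative_const)
qed (simp_all add: submanifold_point)

text \<open>
  Near a point of the zero locus the slice chart sees only one component \<open>N\<close>: the slice of the ball is
  convex, so its image in projective space is connected and meets \<open>N\<close>.
\<close>

lemma zero_component_slice:
  assumes s: "s \<in> H0 m" "\<not> degenerate_section m s"
    and N: "N \<in> components {p. fs_norm2 m s p = 0}" and z: "affine_pt i z \<in> N"
  shows "\<exists>k U r g. wirtinger (chart_fun s i) z k \<noteq> 0 \<and> slice_chart (chart_fun s i) k z U r g \<and>
    (\<forall>y\<in>ball (slice_map (chart_fun s i) k z) r. y $ k = 0 \<longleftrightarrow> affine_pt i (g y) \<in> N)"
proof -
  let ?f = "chart_fun s i" and ?Z = "{p. fs_norm2 m s p = 0}"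
  have Z_iff: "affine_pt i x \<in> ?Z \<longleftrightarrow> ?f x = 0" for x
    by (simp add: H0_fs_norm2[OF s(1)] chart_norm2_eq_0_iff)
  have "N \<subseteq> ?Z" using N by (rule in_components_subset)
  with z have fz: "?f z = 0" using Z_iff by blast
  have "nabla m ?f z \<noteq> 0"
    using fz nondegenerate_sectionD(1)[OF s(2), of i z] by blast
  then obtain k where k: "wirtinger ?f z k \<noteq> 0"
    using fz by (auto simp: nabla_def vec_eq_iff)
  let ?\<Phi> = "slice_map ?f k"
  obtain U r g where chart: "slice_chart ?f k z U r g"
    using slice_chart_exists[OF H0_cpoly[OF s(1)] k] by blast
  then have c: "z \<in> U" "r > 0" "?\<Phi> ` U = ball (?\<Phi> z) r" "\<And>x. x \<in> U \<Longrightarrow> g (?\<Phi> x) = x"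
    "\<And>y. y \<in> ball (?\<Phi> z) r \<Longrightarrow> (g has_derivative slice_inv_deriv ?f k (g y)) (at y)"
    unfolding slice_chart_def by blast+
  let ?B = "ball (?\<Phi> z) r" and ?L = "{y :: (complex, 'a) vec. y $ k = 0}"
  have \<Phi>g: "?\<Phi> (g y) = y" if "y \<in> ?B" for y
  proof -
    obtain x where "x \<in> U" "y = ?\<Phi> x" using \<open>y \<in> ?B\<close> c(3) by blast
    then show ?thesis using c(4) by simp
  qed
  have fg: "?f (g y) = y $ k" if "y \<in> ?B" for y
    using arg_cong[OF \<Phi>g[OF that], of "\<lambda>x. x $ k"] by (simp add: slice_map_nth)
  have "convex (?B \<inter> ?L)"
  proof (intro convex_Int convex_ball subspace_imp_convex)
    show "subspace ?L" by (auto simp: subspace_def)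
  qed
  moreover have "continuous_on (?B \<inter> ?L) g"
    using c(5) by (intro continuous_at_imp_continuous_on ballI has_derivative_continuous) blast
  ultimately have conn: "connected (affine_pt i ` g ` (?B \<inter> ?L))"
    by (intro connected_continuous_image continuous_on_affine_pt convex_connected)
  have sub: "affine_pt i ` g ` (?B \<inter> ?L) \<subseteq> ?Z"
    using fg Z_iff by auto
  have "?\<Phi> z \<in> ?B \<inter> ?L" using c(2) fz by (simp add: slice_map_nth)
  then have "affine_pt i z \<in> affine_pt i ` g ` (?B \<inter> ?L)"
    using c(4)[OF c(1)] by (metis imageI)
  with z have "affine_pt i ` g ` (?B \<inter> ?L) \<subseteq> N"
    using components_maximal[OF N conn sub] by blast
  moreover have "y $ k = 0" if "y \<in> ?B" "affine_pt i (g y) \<in> N" for y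
    using fg[OF that(1)] Z_iff[of "g y"] that(2) \<open>N \<subseteq> ?Z\<close> by auto
  ultimately have "y $ k = 0 \<longleftrightarrow> affine_pt i (g y) \<in> N" if "y \<in> ?B" for y
    using that by blast
  with k chart show ?thesis by blast
qed

lemma submanifold_zero_component:
  assumes s: "s \<in> H0 m" "\<not> degenerate_section m s"
    and N: "N \<in> components {p. fs_norm2 m s p = 0}"
  shows "submanifold N"
  unfolding submanifold_def
proof (intro allI impI)
  fix i z assume z: "affine_pt i z \<in> N"
  obtain k U r g where k: "wirtinger (chart_fun s i) z k \<noteq> 0"
    and chart: "slice_chart (chart_fun s i) k z U r g"
    and slice: "\<And>y. y \<in> ball (slice_map (chart_fun s i) k z) r \<Longrightarrow>
      y $ k = 0 \<longleftrightarrow> affine_pt i (g y) \<in> N"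
    using zero_component_slice[OF s N z] by blast
  from chart have c: "open U" "z \<in> U" "r > 0"
    "slice_map (chart_fun s i) k ` U = ball (slice_map (chart_fun s i) k z) r"
    "\<And>x. x \<in> U \<Longrightarrow> g (slice_map (chart_fun s i) k x) = x"
    "smooth_on U (slice_map (chart_fun s i) k)"
    "smooth_on (ball (slice_map (chart_fun s i) k z) r) g"
    "\<And>y. y \<in> ball (slice_map (chart_fun s i) k z) r \<Longrightarrow>
      (g has_derivative slice_inv_deriv (chart_fun s i) k (g y)) (at y)"
    unfolding slice_chart_def by blast+
  let ?\<Phi> = "slice_map (chart_fun s i) k" and ?L = "{y :: (complex, 'a) vec. y $ k = 0}"
  let ?B = "ball (?\<Phi> z) r"
  have inj: "inj_on ?\<Phi> U" using c(5) by (rule inj_on_inverseI)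
  have "Ck_on d ?B (inv_into U ?\<Phi>)" for d
  proof (rule Ck_on_cong[OF open_ball])
    show "Ck_on d ?B g" using c(7) by (simp add: smooth_on_def)
    fix y assume "y \<in> ?B"
    then obtain x where "x \<in> U" "y = ?\<Phi> x" using c(4) by (metis imageE)
    then show "g y = inv_into U ?\<Phi> y" using c(5) inj by (simp add: inv_into_f_f)
  qed
  then have "diffeo_onto_image U ?\<Phi>"
    unfolding diffeo_onto_image_def c(4) using c(1,6) inj by (simp add: smooth_on_def)
  moreover have "?\<Phi> ` (U \<inter> affine_pt i -` N) = ?\<Phi> ` U \<inter> ?L"
  proof -
    have "affine_pt i x \<in> N \<longleftrightarrow> ?\<Phi> x $ k = 0" if "x \<in> U" for x
      using slice[of "?\<Phi> x"] c(4,5) that by (metis imageI)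
    then show ?thesis by blast
  qed
  moreover have "subspace ?L" by (auto simp: subspace_def)
  ultimately show "\<exists>V \<Phi> L. z \<in> V \<and> diffeo_onto_image V \<Phi> \<and> subspace L \<and>
      \<Phi> ` (V \<inter> affine_pt i -` N) = \<Phi> ` V \<inter> L"
    using c(2) by blast
qed

text \<open>
  The curve is the preimage under the slice chart of a straight line; the line stays in the slice because
  \<open>df(v) = 0\<close>.
\<close>

lemma tangent_zero_component:
  assumes s: "s \<in> H0 m" "\<not> degenerate_section m s"
    and N: "N \<in> components {p. fs_norm2 m s p = 0}" and z: "affine_pt i z \<in> N"
    and v: "(\<Sum>j\<in>UNIV. v $ j * wirtinger (chart_fun s i) z j) = 0"
  shows "v \<in> tangent_space N i z"
proof -
  obtain k U r g where k: "wirtinger (chart_fun s i) z k \<noteq> 0"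
    and chart: "slice_chart (chart_fun s i) k z U r g"
    and slice: "\<And>y. y \<in> ball (slice_map (chart_fun s i) k z) r \<Longrightarrow>
      y $ k = 0 \<longleftrightarrow> affine_pt i (g y) \<in> N"
    using zero_component_slice[OF s N z] by blast
  from chart have c: "open U" "z \<in> U" "r > 0"
    "slice_map (chart_fun s i) k ` U = ball (slice_map (chart_fun s i) k z) r"
    "\<And>x. x \<in> U \<Longrightarrow> g (slice_map (chart_fun s i) k x) = x"
    "smooth_on U (slice_map (chart_fun s i) k)"
    "smooth_on (ball (slice_map (chart_fun s i) k z) r) g"
    "\<And>y. y \<in> ball (slice_map (chart_fun s i) k z) r \<Longrightarrow>
      (g has_derivative slice_inv_deriv (chart_fun s i) k (g y)) (at y)"
    unfolding slice_chart_def by blast+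
  let ?f = "chart_fun s i"
  define y where "y = slice_map ?f k z"
  define w where "w = slice_deriv ?f k z v"
  define \<gamma> where "\<gamma> t = g (y + t *\<^sub>R w)" for t
  have gy: "g y = z" unfolding y_def using c(2,5) by blast
  have y: "y \<in> ball y r" "y $ k = 0"
    using c(3) slice[of y] z gy by (simp_all add: y_def)
  have "w $ k = 0" using v by (simp add: w_def slice_deriv_def)
  with y(2) have k0: "(y + t *\<^sub>R w) $ k = 0" for t by simp
  have line: "((\<lambda>t. y + t *\<^sub>R w) has_derivative (\<lambda>t. t *\<^sub>R w)) (at 0)"
    by (auto intro!: derivative_eq_intros)
  have "((\<lambda>t. y + t *\<^sub>R w) \<longlongrightarrow> y + 0 *\<^sub>R w) (nhds 0)"
    by (intro tendsto_intros filterlim_ident)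
  then have "\<forall>\<^sub>F t in nhds 0. y + t *\<^sub>R w \<in> ball y r"
    using c(3) by (intro topological_tendstoD) auto
  moreover have "affine_pt i (\<gamma> t) \<in> N" if "y + t *\<^sub>R w \<in> ball y r" for t
    using that slice k0[of t] unfolding \<gamma>_def y_def by blast
  ultimately have "\<forall>\<^sub>F t in nhds 0. affine_pt i (\<gamma> t) \<in> N"
    by (rule eventually_mono)
  moreover have "\<gamma> 0 = z" by (simp add: \<gamma>_def gy)
  moreover have "(\<gamma> has_vector_derivative v) (at 0)"
  proof -
    have lin: "(g has_derivative slice_inv_deriv ?f k z) (at (y + 0 *\<^sub>R w))"
      using c(8)[of y] y(1) gy by (simp add: y_def)
    have "slice_inv_deriv ?f k z (t *\<^sub>R w) = t *\<^sub>R v" for t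
      using has_derivative_linear[OF lin] slice_deriv_inverse(1)[OF k, of v]
      by (simp add: linear_cmul w_def)
    with diff_chain_at[OF line lin] show ?thesis
      by (simp add: has_vector_derivative_def \<gamma>_def[abs_def] o_def)
  qed
  ultimately show ?thesis unfolding tangent_space_def by blast
qed

lemma nondegenerate_critical_manifold_zero_component:
  assumes s: "s \<in> H0 m" "\<not> degenerate_section m s"
    and N: "N \<in> components {p. fs_norm2 m s p = 0}"
  shows "nondegenerate_critical_manifold (fs_norm2 m s) N"
  unfolding nondegenerate_critical_manifold_def
proof (intro conjI allI impI)
  show "N \<noteq> {}" using N by (rule in_components_nonempty)
  show "connected N" using N by (rule in_components_connected)
  show "submanifold N" by (rule submanifold_zero_component[OF s N])
  show "N \<subseteq> critical_set (fs_norm2 m s)"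
    using in_components_subset[OF N] by (auto simp: critical_set_fs_norm2[OF s(1)])
  fix i z v
  assume z: "affine_pt i z \<in> N"
    and ker: "\<forall>w. hessian (\<lambda>x. fs_norm2 m s (affine_pt i x)) z v w = 0"
  have "fs_norm2 m s (affine_pt i z) = 0" using in_components_subset[OF N] z by blast
  then have fz: "s (affine_vec i z) = 0"
    by (simp add: H0_fs_norm2[OF s(1)] chart_norm2_eq_0_iff)
  have "chart_hessian_form m (chart_fun s i) z v v = 0"
    using ker hessian_chart_norm2[OF H0_cpoly[OF s(1)], of i z m v v] fz
    by (simp add: H0_fs_norm2[OF s(1)])
  from chart_hessian_zero_locus[OF fz this] show "v \<in> tangent_space N i z"
    by (rule tangent_zero_component[OF s N z])
qed

lemma generalized_morse_fs_norm2:
  assumes s: "s \<in> H0 m" "\<not> degenerate_section m s"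
  shows "generalized_morse (fs_norm2 m s)"
proof -
  let ?C = "{p. section_critical_point m s p}" and ?Z = "{p. fs_norm2 m s p = 0}"
  let ?N = "(\<lambda>p. {p}) ` ?C \<union> components ?Z"
  have "?C \<inter> ?Z = {}"
    using section_critical_point_nondegenerate[OF s]
    by (auto simp: nondegenerate_section_critical_point_def)
  then have "disjoint ?N"
    using pairwise_disjoint_components[of ?Z] in_components_subset[of _ ?Z]
    by (fastforce simp: pairwise_def disjnt_def disjoint_def)
  moreover have "\<Union>?N = critical_set (fs_norm2 m s)"
    by (simp add: critical_set_fs_norm2[OF s(1)])
  moreover have "\<forall>N\<in>?N. nondegenerate_critical_manifold (fs_norm2 m s) N"
    using nondegenerate_critical_manifold_point[OF s]
      nondegenerate_critical_manifold_zero_component[OF s] by blast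
  ultimately show ?thesis
    unfolding generalized_morse_def using smooth_function_fs_norm2[OF s(1)] by blast
qed

theorem theorem1p4:
  fixes m :: nat
  assumes "m \<ge> 1"
  shows "\<exists>E :: ((complex, 'n::finite option) vec \<Rightarrow> complex) set.
    E \<subseteq> H0 m \<and> H0_null_set m E \<and>
    (\<forall>s \<in> H0 m - E.
      (\<forall>p. section_critical_point m s p \<longrightarrow>
        nondegenerate_section_critical_point m s p \<and>
        p isolated_in {q. section_critical_point m s q}) \<and>
      generalized_morse (fs_norm2 m s))"
proof (intro exI[of _ "{s \<in> H0 m. degenerate_section m s}"] conjI ballI)
  show "H0_null_set m {s \<in> H0 m. degenerate_section m s}"
    by (rule H0_null_set_degenerate[OF assms])
next
  fix s :: "(complex, 'n option) vec \<Rightarrow> complex"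
  assume "s \<in> H0 m - {s \<in> H0 m. degenerate_section m s}"
  then have s: "s \<in> H0 m" "\<not> degenerate_section m s" by auto
  show "\<forall>p. section_critical_point m s p \<longrightarrow>
      nondegenerate_section_critical_point m s p \<and>
      p isolated_in {q. section_critical_point m s q}"
    using section_critical_point_nondegenerate[OF s] section_critical_point_isolated[OF s] by blast
  show "generalized_morse (fs_norm2 m s)"
    by (rule generalized_morse_fs_norm2[OF s])
qed auto

end
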